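(* Let $I$ be a linearly ordered set, and let $B$ and $A_1^{\mathbb{R}}$ be the $*$-algebras described in the context. Let $i,j,k,l\in I$ be four different indices in arbitrary order, and let $C_{ijkl}=(il)(kl)^{-1}(kj)(ij)^{-1}$, where $(ij)=q^{-1/2}x_iy_j-q^{1/2}y_ix_j$. Write $C_{ijkl}^*=f(C_{ijkl},q^2)$, where $f=f(z,t)$ is the rational function attached to the order type of $(i,j,k,l)$ as listed in the context. Then $f(C_{ijkl},q)$ is a $*$-invariant element of $A_1^{\mathbb{R}}$, i.e. $f(C_{ijkl},q)\in A_1^{\mathbb{R}}$ and $f(C_{ijkl},q)^*=f(C_{ijkl},q)$.
   Context: Fix $q\in\mathbb{C}$ with $|q|=1$, $q\ne\pm1,\pm i$, and a square root $q^{1/2}$ (so $\overline{q^{1/2}}=q^{-1/2}$). $B$ is the unital complex algebra generated by $x_i,y_i,y_i^{-1}$ ($i\in I$) and inverses of the nonvanishing finite linear combinations $\sum\alpha_ix_iy_i^{-1}$, with relations $x_iy_i=qy_ix_i$ for all $i$ and, for $i<j$, $$x_jx_i=q^2x_ix_j,\quad y_jy_i=q^2y_iy_j,\quad x_jy_i=qy_ix_j+(q^2-1)x_iy_j,\quad y_jx_i=qx_iy_j .$$ It carries the antilinear antimultiplicative involution $*$ with $x_i^*=x_i$, $y_i^*=y_i$. The elements $v_i=q^{1/2}x_iy_i^{-1}$ satisfy $v_i^*=v_i$ and $[v_j,v_i]=v_jv_i-v_iv_j=(q^2-1)v_i(v_j-v_i)$ for $i<j$, and $C_{ijkl}$ lies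 in the $*$-algebra $A_1^{\mathbb{R}}$ generated by the $v_m$ and the inverses of nonvanishing finite linear combinations of them. The rational functions $f$: let $a<b<c<d$ be the indices $i,j,k,l$ in increasing order. For $(i,j,k,l)$ equal to one of the following, $f(z,t)$ is: - $(a,b,c,d)$ or $(c,d,a,b)$: $f(z,t)=tz$; - $(a,d,c,b)$ or $(c,b,a,d)$: $f(z,t)=t^{-1}z$; - $(a,b,d,c)$ or $(c,d,b,a)$: $f(z,t)=tz+(1-t)$; - $(a,c,b,d)$ or $(c,a,d,b)$: $f(z,t)=\dfrac{tz}{1+(t-1)z}$; - $(a,c,d,b)$ or $(c,a,b,d)$: $f(z,t)=\dfrac{z}{t+(1-t)z}$; - $(a,d,b,c)$ or $(c,b,d,a)$: $f(z,t)=t^{-1}z+(1-t^{-1})$. For the remaining twelve orderings $f(z,t)$ is obtained by replacing $t$ by $t^{-1}$ in the corresponding entry: $(b,a,d,c),(d,c,b,a)$ correspond to the first line; $(b,c,d,a),(d,a,b,c)$ to the second; $(b,a,c,d),(d,c,a,b)$ to the third; $(b,d,a,c),(d,b,c,a)$ to the fourth; $(b,d,c,a),(d,b,a,c)$ to the fifth; $(b,c,a,d),(d,a,c,b)$ to the sixth.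
   Formalization: f(C,q) is claimed to be a *-invariant element only when its denominator at C is invertible in B; this can fail for orderings in lines four and five, e.g. (a,c,b,d) with q a primitive 8th root of unity. Invariance with denominators cleared is stated unconditionally. *)

theory Defs
  imports Complex_Main "HOL-Library.Poly_Mapping"
begin

subsection \<open>Free complex algebras and presentations\<close>

datatype 'g word = Word (letters: "'g list")

instantiation word :: (type) monoid_add
begin

definition zero_word :: "'g word"
  where "zero_word = Word []"

definition plus_word :: "'g word \<Rightarrow> 'g word \<Rightarrow> 'g word"
  where "plus_word u w = Word (letters u @ letters w)"

instance
  by standard (simp_all add: zero_word_def plus_word_def)

end

text \<open>Concatenation of words is written additively, so that the convolution product of
  \<open>Poly_Mapping\<close> is the product of noncommutative polynomials.\<close>

type_synonym 'g free_alg = "'g word \<Rightarrow>\<^sub>0 complex"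

definition scal :: "complex \<Rightarrow> 'g free_alg"
  where "scal r = Poly_Mapping.single 0 r"

definition gen :: "'g \<Rightarrow> 'g free_alg"
  where "gen g = Poly_Mapping.single (Word [g]) 1"

definition two_sided_ideal :: "'r::ring_1 set \<Rightarrow> bool"
  where "two_sided_ideal J \<longleftrightarrow>
    0 \<in> J \<and> (\<forall>a\<in>J. \<forall>b\<in>J. a + b \<in> J) \<and> (\<forall>a\<in>J. \<forall>r. r * a \<in> J \<and> a * r \<in> J)"

text \<open>\<open>presents R \<pi>\<close>: the ring \<open>'b\<close> is, via \<open>\<pi>\<close>, the quotient of the free complex algebra by the
  two-sided ideal generated by \<open>R\<close>. Its complex scalars are \<open>\<pi> (scal r)\<close>.\<close>

definition presents :: "'g free_alg set \<Rightarrow> ('g free_alg \<Rightarrow> 'b::ring_1) \<Rightarrow> bool"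
  where "presents R \<pi> \<longleftrightarrow>
    \<pi> 1 = 1 \<and> (\<forall>a b. \<pi> (a + b) = \<pi> a + \<pi> b) \<and> (\<forall>a b. \<pi> (a * b) = \<pi> a * \<pi> b) \<and>
    surj \<pi> \<and> (\<forall>a. \<pi> a = 0 \<longleftrightarrow> a \<in> two_sided_ideal hull R)"

definition invertible_elt :: "'r::ring_1 \<Rightarrow> bool"
  where "invertible_elt a \<longleftrightarrow> (\<exists>b. a * b = 1 \<and> b * a = 1)"

definition inverse_elt :: "'r::ring_1 \<Rightarrow> 'r"
  where "inverse_elt a = (THE b. a * b = 1 \<and> b * a = 1)"

subsection \<open>The algebra \<open>B\<close>\<close>

text \<open>Throughout, \<open>\<iota>\<close> is the embedding of the complex scalars.\<close>

definition xy_rels ::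
    "complex \<Rightarrow> (complex \<Rightarrow> 'r) \<Rightarrow> ('i::linorder \<Rightarrow> 'r) \<Rightarrow> ('i \<Rightarrow> 'r) \<Rightarrow> ('i \<Rightarrow> 'r) \<Rightarrow> 'r::ring_1 set"
  where "xy_rels q \<iota> x y yinv =
    (\<Union>i. {y i * yinv i - 1, yinv i * y i - 1, x i * y i - \<iota> q * y i * x i}) \<union>
    (\<Union>i. \<Union>j\<in>{i<..}.
      {x j * x i - \<iota> (q^2) * x i * x j,
       y j * y i - \<iota> (q^2) * y i * y j,
       x j * y i - (\<iota> q * y i * x j + \<iota> (q^2 - 1) * x i * y j),
       y j * x i - \<iota> q * x i * y j})"

definition lincomb :: "(complex \<Rightarrow> 'r::ring_1) \<Rightarrow> ('i \<Rightarrow> 'r) \<Rightarrow> ('i \<Rightarrow>\<^sub>0 complex) \<Rightarrow> 'r"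
  where "lincomb \<iota> v \<alpha> = (\<Sum>i\<in>Poly_Mapping.keys \<alpha>. \<iota> (Poly_Mapping.lookup \<alpha> i) * v i)"

datatype 'i gen_xy = X 'i | Y 'i | Yinv 'i

text \<open>The sum of the \<open>\<alpha>\<^sub>i x\<^sub>i / y\<^sub>i\<close> is nonzero in the algebra generated by \<open>x\<^sub>i\<close>, \<open>y\<^sub>i\<close> and the inverses of the \<open>y\<^sub>i\<close> alone.\<close>

definition nonvanishing :: "complex \<Rightarrow> ('i::linorder \<Rightarrow>\<^sub>0 complex) \<Rightarrow> bool"
  where "nonvanishing q \<alpha> \<longleftrightarrow>
    lincomb scal (\<lambda>i. gen (X i) * gen (Yinv i)) \<alpha> \<notin>
      two_sided_ideal hull
        xy_rels q scal (\<lambda>i. gen (X i)) (\<lambda>i. gen (Y i)) (\<lambda>i. gen (Yinv i))"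

datatype 'i gen_B = XY "'i gen_xy" | LinInv "'i \<Rightarrow>\<^sub>0 complex"

text \<open>The letters \<open>LinInv \<alpha>\<close> with vanishing linear combination are not wanted as generators;
  the last set of relations removes them.\<close>

definition B_rels :: "complex \<Rightarrow> 'i::linorder gen_B free_alg set"
  where "B_rels q =
    xy_rels q scal (\<lambda>i. gen (XY (X i))) (\<lambda>i. gen (XY (Y i))) (\<lambda>i. gen (XY (Yinv i))) \<union>
    (\<Union>\<alpha>\<in>{\<alpha>. nonvanishing q \<alpha>}.
      let s = lincomb scal (\<lambda>i. gen (XY (X i)) * gen (XY (Yinv i))) \<alpha>
      in {s * gen (LinInv \<alpha>) - 1, gen (LinInv \<alpha>) * s - 1}) \<union>
    {gen (LinInv \<alpha>) | \<alpha>. \<not> nonvanishing q \<alpha>}"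

definition Bscal :: "('i gen_B free_alg \<Rightarrow> 'b) \<Rightarrow> complex \<Rightarrow> 'b"
  where "Bscal \<pi> r = \<pi> (scal r)"

definition Bx :: "('i gen_B free_alg \<Rightarrow> 'b) \<Rightarrow> 'i \<Rightarrow> 'b"
  where "Bx \<pi> i = \<pi> (gen (XY (X i)))"

definition By :: "('i gen_B free_alg \<Rightarrow> 'b) \<Rightarrow> 'i \<Rightarrow> 'b"
  where "By \<pi> i = \<pi> (gen (XY (Y i)))"

definition Byinv :: "('i gen_B free_alg \<Rightarrow> 'b) \<Rightarrow> 'i \<Rightarrow> 'b"
  where "Byinv \<pi> i = \<pi> (gen (XY (Yinv i)))"

text \<open>The conditions below determine \<open>star\<close> uniquely, because \<open>star\<close> has to respect inverses.\<close>

definition B_star :: "('i gen_B free_alg \<Rightarrow> 'b::ring_1) \<Rightarrow> ('b \<Rightarrow> 'b) \<Rightarrow> bool"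
  where "B_star \<pi> star \<longleftrightarrow>
    (\<forall>a b. star (a + b) = star a + star b) \<and>
    (\<forall>r a. star (Bscal \<pi> r * a) = Bscal \<pi> (cnj r) * star a) \<and>
    (\<forall>a b. star (a * b) = star b * star a) \<and>
    (\<forall>a. star (star a) = a) \<and>
    (\<forall>i. star (Bx \<pi> i) = Bx \<pi> i) \<and> (\<forall>i. star (By \<pi> i) = By \<pi> i)"

subsection \<open>The \<open>*\<close>-algebra generated by the \<open>v\<^sub>i\<close>, and the elements \<open>C\<^sub>i\<^sub>j\<^sub>k\<^sub>l\<close>\<close>

text \<open>From here on, \<open>qh\<close> is the chosen square root of \<open>q\<close>.\<close>

definition Bv :: "complex \<Rightarrow> ('i gen_B free_alg \<Rightarrow> 'b::ring_1) \<Rightarrow> 'i \<Rightarrow> 'b"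
  where "Bv qh \<pi> i = Bscal \<pi> qh * Bx \<pi> i * Byinv \<pi> i"

definition star_subalgebra :: "(complex \<Rightarrow> 'b::ring_1) \<Rightarrow> ('b \<Rightarrow> 'b) \<Rightarrow> 'b set \<Rightarrow> bool"
  where "star_subalgebra \<iota> star S \<longleftrightarrow>
    range \<iota> \<subseteq> S \<and> (\<forall>a\<in>S. \<forall>b\<in>S. a + b \<in> S \<and> a * b \<in> S) \<and> (\<forall>a\<in>S. star a \<in> S)"

definition A1R :: "complex \<Rightarrow> ('i gen_B free_alg \<Rightarrow> 'b::ring_1) \<Rightarrow> ('b \<Rightarrow> 'b) \<Rightarrow> 'b set"
  where "A1R qh \<pi> star = star_subalgebra (Bscal \<pi>) star hull
    (range (Bv qh \<pi>) \<union>
     {inverse_elt s | s. s \<in> range (lincomb (Bscal \<pi>) (Bv qh \<pi>)) \<and> s \<noteq> 0})"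

definition bracket :: "complex \<Rightarrow> ('i gen_B free_alg \<Rightarrow> 'b::ring_1) \<Rightarrow> 'i \<Rightarrow> 'i \<Rightarrow> 'b"
  where "bracket qh \<pi> i j =
    Bscal \<pi> (inverse qh) * Bx \<pi> i * By \<pi> j - Bscal \<pi> qh * By \<pi> i * Bx \<pi> j"

definition cross_ratio ::
    "complex \<Rightarrow> ('i gen_B free_alg \<Rightarrow> 'b::ring_1) \<Rightarrow> 'i \<Rightarrow> 'i \<Rightarrow> 'i \<Rightarrow> 'i \<Rightarrow> 'b"
  where "cross_ratio qh \<pi> i j k l =
    bracket qh \<pi> i l * inverse_elt (bracket qh \<pi> k l) *
    bracket qh \<pi> k j * inverse_elt (bracket qh \<pi> i j)"

subsection \<open>The rational functions \<open>f(z, t)\<close>\<close>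

text \<open>A rational function is given by the pair of its numerator and its denominator, evaluated at
  an algebra element \<open>z\<close>. Both are polynomials in \<open>z\<close>, so they commute.\<close>

datatype family = F1 | F2 | F3 | F4 | F5 | F6

primrec family_fun :: "family \<Rightarrow> (complex \<Rightarrow> 'b::ring_1) \<Rightarrow> complex \<Rightarrow> 'b \<Rightarrow> 'b \<times> 'b"
  where
    "family_fun F1 \<iota> t z = (\<iota> t * z, 1)"
  | "family_fun F2 \<iota> t z = (\<iota> (inverse t) * z, 1)"
  | "family_fun F3 \<iota> t z = (\<iota> t * z + \<iota> (1 - t), 1)"
  | "family_fun F4 \<iota> t z = (\<iota> t * z, 1 + \<iota> (t - 1) * z)"
  | "family_fun F5 \<iota> t z = (z, \<iota> t + \<iota> (1 - t) * z)"
  | "family_fun F6 \<iota> t z = (\<iota> (inverse t) * z + \<iota> (1 - inverse t), 1)"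

definition f_frac ::
    "'i::linorder \<Rightarrow> 'i \<Rightarrow> 'i \<Rightarrow> 'i \<Rightarrow> (complex \<Rightarrow> 'b::ring_1) \<Rightarrow> complex \<Rightarrow> 'b \<Rightarrow> 'b \<times> 'b"
  where "f_frac i j k l \<iota> t z =
    (let s = sort [i, j, k, l]; a = s ! 0; b = s ! 1; c = s ! 2; d = s ! 3; p = (i, j, k, l)
     in if p \<in> {(a,b,c,d), (c,d,a,b)} then family_fun F1 \<iota> t z
        else if p \<in> {(a,d,c,b), (c,b,a,d)} then family_fun F2 \<iota> t z
        else if p \<in> {(a,b,d,c), (c,d,b,a)} then family_fun F3 \<iota> t z
        else if p \<in> {(a,c,b,d), (c,a,d,b)} then family_fun F4 \<iota> t z
        else if p \<in> {(a,c,d,b), (c,a,b,d)} then family_fun F5 \<iota> t z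
        else if p \<in> {(a,d,b,c), (c,b,d,a)} then family_fun F6 \<iota> t z
        else if p \<in> {(b,a,d,c), (d,c,b,a)} then family_fun F1 \<iota> (inverse t) z
        else if p \<in> {(b,c,d,a), (d,a,b,c)} then family_fun F2 \<iota> (inverse t) z
        else if p \<in> {(b,a,c,d), (d,c,a,b)} then family_fun F3 \<iota> (inverse t) z
        else if p \<in> {(b,d,a,c), (d,b,c,a)} then family_fun F4 \<iota> (inverse t) z
        else if p \<in> {(b,d,c,a), (d,b,a,c)} then family_fun F5 \<iota> (inverse t) z
        else family_fun F6 \<iota> (inverse t) z)"

abbreviation f_num ::
    "'i::linorder \<Rightarrow> 'i \<Rightarrow> 'i \<Rightarrow> 'i \<Rightarrow> (complex \<Rightarrow> 'b::ring_1) \<Rightarrow> complex \<Rightarrow> 'b \<Rightarrow> 'b"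
  where "f_num i j k l \<iota> t z \<equiv> fst (f_frac i j k l \<iota> t z)"

abbreviation f_den ::
    "'i::linorder \<Rightarrow> 'i \<Rightarrow> 'i \<Rightarrow> 'i \<Rightarrow> (complex \<Rightarrow> 'b::ring_1) \<Rightarrow> complex \<Rightarrow> 'b \<Rightarrow> 'b"
  where "f_den i j k l \<iota> t z \<equiv> snd (f_frac i j k l \<iota> t z)"

text \<open>The value \<open>f(z, t)\<close>; meaningful only if the denominator is invertible. The denominator is
  \<open>1\<close> except in the families \<open>F4\<close> and \<open>F5\<close>, where for \<open>z = C\<^sub>i\<^sub>j\<^sub>k\<^sub>l\<close> and \<open>t = q\<close> it need not be
  invertible in \<open>B\<close>: it is not for \<open>i < k < j < l\<close> and \<open>q\<close> a primitive eighth root of unity.\<close>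

definition f_val ::
    "'i::linorder \<Rightarrow> 'i \<Rightarrow> 'i \<Rightarrow> 'i \<Rightarrow> (complex \<Rightarrow> 'b::ring_1) \<Rightarrow> complex \<Rightarrow> 'b \<Rightarrow> 'b"
  where "f_val i j k l \<iota> t z = f_num i j k l \<iota> t z * inverse_elt (f_den i j k l \<iota> t z)"

end

theory Submission
  imports Defs
begin

text \<open>One has \<open>(ij) = y\<^sub>i (v\<^sub>i - v\<^sub>j) y\<^sub>j\<close>, and the brackets are antisymmetric and \<open>*\<close>-invariant. For
  \<open>a < b\<close> the bracket \<open>(ab)\<close> commutes with \<open>v\<^sub>m\<close> and commutes up to a power of \<open>q\<close> with \<open>y\<^sub>m\<close>
  whenever \<open>m \<le> a\<close> or \<open>b \<le> m\<close>. So for \<open>a < b < c < d\<close> the brackets \<open>(ab)\<close>, \<open>(bc)\<close>, \<open>(cd)\<close>, \<open>(ad)\<close>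
  commute up to powers of \<open>q\<close>, and reversing the product \<open>C\<close> gives \<open>C* = q\<^sup>2 C\<close> for \<open>C\<^sub>a\<^sub>b\<^sub>c\<^sub>d\<close> and
  \<open>C\<^sub>c\<^sub>d\<^sub>a\<^sub>b\<close>, and the same with the inverse of \<open>q\<close> for \<open>C\<^sub>b\<^sub>a\<^sub>d\<^sub>c\<close> and \<open>C\<^sub>d\<^sub>c\<^sub>b\<^sub>a\<close>. The other orders follow
  from \<open>C\<^sub>i\<^sub>j\<^sub>l\<^sub>k = 1 - C\<^sub>i\<^sub>j\<^sub>k\<^sub>l\<close> and the fact that \<open>C\<^sub>i\<^sub>l\<^sub>k\<^sub>j\<close> is the inverse of \<open>C\<^sub>i\<^sub>j\<^sub>k\<^sub>l\<close>.

  For membership in \<open>A\<^sub>1\<close>, grade \<open>B\<close> by giving \<open>x\<^sub>i\<close> and \<open>y\<^sub>i\<close> the degree \<open>i\<close>. Inverses of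
  homogeneous elements are homogeneous, since their homogeneous components can be split off, and
  the part of degree zero is contained in \<open>A\<^sub>1\<close>: in a word all letters \<open>y\<close> can be collected on the right,
  where they cancel up to a scalar. This covers the inverse of the denominator of \<open>f(C, q)\<close>
  whenever it exists. That \<open>v\<^sub>i - v\<^sub>j\<close> is invertible needs an explicit representation in which it
  does not vanish.\<close>

section \<open>Noncommutative polynomials: reduction to monomials, scalars, linear
  combinations\<close>

lemma poly_mapping_linear_induct [case_names single add]:
  assumes "\<And>w c. P (Poly_Mapping.single w c)"
    and "\<And>p r. P p \<Longrightarrow> P r \<Longrightarrow> P (p + r)"
  shows "P (p :: 'a \<Rightarrow>\<^sub>0 'c::comm_monoid_add)"
proof (induction p rule: update_induct)
  case const
  show ?case using assms(1)[of undefined 0] by simp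
next
  case (update f a b)
  have "Poly_Mapping.update a b f = f + Poly_Mapping.single a b"
    using update.hyps(1)
    by (intro poly_mapping_eqI) (auto simp: lookup_update lookup_add lookup_single in_keys_iff)
  then show ?case using assms update.IH by metis
qed

lemma scal_add: "scal (r + s) = scal r + scal s"
  and scal_mult: "scal (r * s) = scal r * scal s"
  and scal_0 [simp]: "scal 0 = 0"
  and scal_1 [simp]: "scal 1 = 1"
  by (simp_all add: scal_def single_add mult_single)

lemma scal_commute: "p * scal r = scal r * p"
  by (induction p rule: poly_mapping_linear_induct)
    (simp_all add: scal_def mult_single algebra_simps)

lemma single_Word_Nil: "Poly_Mapping.single (Word []) r = scal r"
  by (simp add: scal_def zero_word_def)

lemma single_Word_Cons:
  "Poly_Mapping.single (Word (g # w)) c = gen g * Poly_Mapping.single (Word w) c"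
  by (simp add: gen_def mult_single plus_word_def)

lemma plus_Word [simp]: "Word u + Word w = Word (u @ w)"
  by (simp add: plus_word_def)

lemma lincomb_0 [simp]: "lincomb \<iota> v 0 = 0"
  by (simp add: lincomb_def)

lemma lincomb_single: "\<iota> 0 = 0 \<Longrightarrow> lincomb \<iota> v (Poly_Mapping.single i r) = \<iota> r * v i"
  by (simp add: lincomb_def)

lemma lincomb_add:
  assumes "\<iota> 0 = 0" and "\<And>r s. \<iota> (r + s) = \<iota> r + \<iota> s"
  shows "lincomb \<iota> v (\<alpha> + \<beta>) = lincomb \<iota> v \<alpha> + lincomb \<iota> v \<beta>"
  unfolding lincomb_def
  by (rule setsum_keys_plus_distrib) (simp_all add: assms distrib_right)

lemmas lincomb_scal_simps =
  lincomb_single[where \<iota> = scal, OF scal_0] lincomb_add[where \<iota> = scal, OF scal_0 scal_add]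

subsection \<open>A representation separating the elements \<open>v\<^sub>i\<close>\<close>

text \<open>States are functions \<open>h\<close> on the index set with an extra point \<open>None\<close>. Each letter acts on
  functions of states as a weighted shift: \<open>y\<^sub>m\<close> multiplies by \<open>q\<close> to the power \<open>h m\<close> and shifts by
  \<open>shift_vec n m\<close>; \<open>x\<^sub>m\<close> acts as \<open>0\<close> for \<open>m < n\<close>, and as \<open>y\<^sub>m\<close> times \<open>q\<close> to the power \<open>h None\<close>
  otherwise.\<close>

definition shift_vec :: "'i::linorder \<Rightarrow> 'i \<Rightarrow> 'i option \<Rightarrow> int"
  where "shift_vec n m z = (case z of None \<Rightarrow> if m < n then 1 else -1
    | Some i \<Rightarrow> if i < m then 1 else if i = m then 0 else -1)"

lemma shift_vec_simps [simp]:
  "shift_vec n m None = (if m < n then 1 else -1)"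
  "shift_vec n m (Some i) = (if i < m then 1 else if i = m then 0 else -1)"
  by (simp_all add: shift_vec_def)

primrec letter_weight :: "complex \<Rightarrow> 'i::linorder \<Rightarrow> 'i gen_xy \<Rightarrow> ('i option \<Rightarrow> int) \<Rightarrow> complex"
  where
    "letter_weight q n (X m) h = (if m < n then 0 else q powi (h None + h (Some m)))"
  | "letter_weight q n (Y m) h = q powi (h (Some m))"
  | "letter_weight q n (Yinv m) h = q powi (- h (Some m))"

primrec letter_shift :: "'i::linorder \<Rightarrow> 'i gen_xy \<Rightarrow> ('i option \<Rightarrow> int) \<Rightarrow> 'i option \<Rightarrow> int"
  where
    "letter_shift n (X m) h = (\<lambda>z. h z + shift_vec n m z)"
  | "letter_shift n (Y m) h = (\<lambda>z. h z + shift_vec n m z)"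
  | "letter_shift n (Yinv m) h = (\<lambda>z. h z - shift_vec n m z)"

primrec word_weight :: "complex \<Rightarrow> 'i::linorder \<Rightarrow> 'i gen_xy list \<Rightarrow> ('i option \<Rightarrow> int) \<Rightarrow> complex"
  where
    "word_weight q n [] h = 1"
  | "word_weight q n (g # w) h = letter_weight q n g h * word_weight q n w (letter_shift n g h)"

primrec word_shift :: "'i::linorder \<Rightarrow> 'i gen_xy list \<Rightarrow> ('i option \<Rightarrow> int) \<Rightarrow> 'i option \<Rightarrow> int"
  where
    "word_shift n [] h = h"
  | "word_shift n (g # w) h = word_shift n w (letter_shift n g h)"

lemma word_shift_append: "word_shift n (u @ w) h = word_shift n w (word_shift n u h)"
  by (induction u arbitrary: h) auto

lemma word_weight_append:
  "word_weight q n (u @ w) h = word_weight q n u h * word_weight q n w (word_shift n u h)"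
  by (induction u arbitrary: h) auto

text \<open>The leftmost letter moves the state first and the remaining letters see the moved state.
  With this order a product acts as the composite of the operators of its factors, so the free
  algebra acts on functions of states from the left.\<close>

definition rep :: "complex \<Rightarrow> 'i::linorder \<Rightarrow> 'i gen_xy free_alg \<Rightarrow>
    (('i option \<Rightarrow> int) \<Rightarrow> complex) \<Rightarrow> ('i option \<Rightarrow> int) \<Rightarrow> complex"
  where "rep q n p f h = (\<Sum>w\<in>Poly_Mapping.keys p.
    Poly_Mapping.lookup p w * (word_weight q n (letters w) h * f (word_shift n (letters w) h)))"

lemma rep_add: "rep q n (p + r) f h = rep q n p f h + rep q n r f h"
  unfolding rep_def by (rule setsum_keys_plus_distrib) (simp_all add: distrib_right)

lemma rep_single: "rep q n (Poly_Mapping.single (Word w) c) f h =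
    c * (word_weight q n w h * f (word_shift n w h))"
  by (simp add: rep_def)

lemma rep_uminus: "rep q n (- p) f h = - rep q n p f h"
  by (simp add: rep_def sum_negf)

lemma rep_diff: "rep q n (p - r) f h = rep q n p f h - rep q n r f h"
  using rep_add[of q n p "- r"] by (simp add: rep_uminus)

lemma rep_0: "rep q n 0 f h = 0"
  by (simp add: rep_def)

lemma rep_sum_fun: "rep q n p (\<lambda>h. f h + f' h) h = rep q n p f h + rep q n p f' h"
  by (simp add: rep_def sum.distrib algebra_simps)

lemma rep_mult: "rep q n (p * r) f h = rep q n p (rep q n r f) h"
proof (induction p arbitrary: f h rule: poly_mapping_linear_induct)
  case (single u c)
  obtain u' where u: "u = Word u'" by (cases u)
  show ?case
  proof (induction r rule: poly_mapping_linear_induct)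
    case (single w d)
    obtain w' where w: "w = Word w'" by (cases w)
    show ?case
      by (simp add: u w mult_single rep_single word_weight_append word_shift_append)
  next
    case (add p r)
    have "rep q n (p + r) f = (\<lambda>h. rep q n p f h + rep q n r f h)"
      by (rule ext) (rule rep_add)
    then show ?case
      using add by (simp add: distrib_left rep_add rep_sum_fun)
  qed
qed (simp_all add: rep_add distrib_right)

lemma rep_gen: "rep q n (gen g) f h = letter_weight q n g h * f (letter_shift n g h)"
  by (simp add: gen_def rep_single)

lemma rep_scal: "rep q n (scal c) f h = c * f h"
  by (simp add: single_Word_Nil[symmetric] rep_single)

lemma rep_1: "rep q n 1 f h = f h"
  using rep_scal[of q n 1 f h] by simp

lemmas rep_simps = rep_add rep_diff rep_mult rep_gen rep_scal rep_1 rep_0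

text \<open>Shifts commute, so both sides of a relation move the state equally and only the weights
  need comparison. The vector of \<open>y m\<close> vanishes at \<open>Some m\<close>, which makes
  \<open>Yinv m\<close> its exact inverse. The sign change at \<open>None\<close> keeps the relation
  for \<open>x j * y i\<close> true when \<open>i < n \<le> j\<close>, where the term with
  \<open>x i\<close> acts as zero.\<close>

lemma rep_rels_eq_0:
  assumes q: "q \<noteq> 0"
    and r: "r \<in> xy_rels q scal (\<lambda>i. gen (X i)) (\<lambda>i. gen (Y i)) (\<lambda>i. gen (Yinv i))"
  shows "rep q n r f h = 0"
proof -
  have comm: "(\<lambda>z. h z + shift_vec n i z + shift_vec n j z) =
      (\<lambda>z. h z + shift_vec n j z + shift_vec n i z)" for i j
    by (simp add: add_ac)
  have "r \<in> xy_rels q scal (\<lambda>i. gen (X i)) (\<lambda>i. gen (Y i)) (\<lambda>i. gen (Yinv i)) \<Longrightarrow>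
      rep q n r f h = 0"
    unfolding xy_rels_def
    by (elim UnE UN_E insertE emptyE; hypsubst; insert q;
      auto simp: rep_simps comm power_int_add power_int_diff power_int_minus divide_simps
        power2_eq_square;
      simp add: algebra_simps)
  then show ?thesis using r .
qed

lemma rep_ideal_eq_0:
  assumes q: "q \<noteq> 0"
    and p: "p \<in> two_sided_ideal hull
      xy_rels q scal (\<lambda>i. gen (X i)) (\<lambda>i. gen (Y i)) (\<lambda>i. gen (Yinv i))"
  shows "rep q n p f h = 0"
proof -
  have zero: "rep q n r (\<lambda>h. 0) h = 0" for r h
    by (simp add: rep_def)
  \<comment> \<open>Quantifying over all \<open>f\<close> describes the kernel of the action, which
    is closed under multiplication from both sides.\<close>
  let ?K = "{p. \<forall>f. rep q n p f = (\<lambda>h. 0)}"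
  have "two_sided_ideal ?K"
    unfolding two_sided_ideal_def by (auto intro!: ext simp: rep_simps zero)
  then have "two_sided_ideal hull
      xy_rels q scal (\<lambda>i. gen (X i)) (\<lambda>i. gen (Y i)) (\<lambda>i. gen (Yinv i)) \<subseteq> ?K"
    using rep_rels_eq_0[OF q] by (intro hull_minimal) (auto simp: fun_eq_iff)
  then show ?thesis using p by (auto simp: fun_eq_iff dest: subsetD)
qed

text \<open>With the threshold placed at \<open>j\<close>, the smaller index \<open>i\<close>
  contributes zero whatever \<open>c\<close> is. The remaining term sends the constant function 1 to
  the value 1 at the zero state.\<close>

lemma nonvanishing_diff:
  fixes i j :: "'i::linorder"
  assumes q: "q \<noteq> 0" and ij: "i < j"
  shows "nonvanishing q (Poly_Mapping.single i c + Poly_Mapping.single j 1)"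
  unfolding nonvanishing_def
proof
  assume "lincomb scal (\<lambda>i. gen (X i) * gen (Yinv i))
      (Poly_Mapping.single i c + Poly_Mapping.single j 1) \<in>
    two_sided_ideal hull xy_rels q scal (\<lambda>i. gen (X i)) (\<lambda>i. gen (Y i)) (\<lambda>i. gen (Yinv i))"
    (is "?p \<in> _")
  then have "rep q j ?p (\<lambda>_. 1) (\<lambda>_. 0) = 0"
    by (rule rep_ideal_eq_0[OF q])
  then show False
    using ij q by (simp add: lincomb_scal_simps rep_simps split: if_splits)
qed

subsection \<open>Inverses in a ring\<close>

lemma inverse_elt_eqI: "a * b = 1 \<Longrightarrow> b * a = 1 \<Longrightarrow> inverse_elt a = (b :: 'r::ring_1)"
  unfolding inverse_elt_def by (rule the_equality) (auto, metis mult.assoc mult_1_left mult_1_right)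

lemma invertible_eltI: "a * b = 1 \<Longrightarrow> b * a = 1 \<Longrightarrow> invertible_elt (a :: 'r::ring_1)"
  unfolding invertible_elt_def by blast

lemma inverse_elt:
  assumes "invertible_elt (a :: 'r::ring_1)"
  shows inverse_elt_right: "a * inverse_elt a = 1" and inverse_elt_left: "inverse_elt a * a = 1"
  using assms inverse_elt_eqI unfolding invertible_elt_def by metis+

lemma inverse_elt_cancel:
  assumes "invertible_elt (a :: 'r::ring_1)"
  shows "a * (inverse_elt a * b) = b" and "inverse_elt a * (a * b) = b"
  using inverse_elt[OF assms] by (simp_all flip: mult.assoc)

lemma invertible_elt_inverse: "invertible_elt a \<Longrightarrow> invertible_elt (inverse_elt a)"
  and inverse_elt_inverse: "invertible_elt a \<Longrightarrow> inverse_elt (inverse_elt a) = a"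
  for a :: "'r::ring_1"
  by (metis inverse_elt invertible_eltI) (metis inverse_elt inverse_elt_eqI)

lemma
  assumes "invertible_elt (a :: 'r::ring_1)" and "invertible_elt b"
  shows invertible_elt_mult: "invertible_elt (a * b)"
    and inverse_elt_mult: "inverse_elt (a * b) = inverse_elt b * inverse_elt a"
proof -
  have "a * b * (inverse_elt b * inverse_elt a) = 1" "inverse_elt b * inverse_elt a * (a * b) = 1"
    using assms by (simp_all add: mult.assoc inverse_elt_cancel inverse_elt)
  then show "invertible_elt (a * b)" "inverse_elt (a * b) = inverse_elt b * inverse_elt a"
    by (auto intro: invertible_eltI inverse_elt_eqI)
qed

lemma invertible_elt_1 [simp]: "invertible_elt (1 :: 'r::ring_1)"
  and inverse_elt_1 [simp]: "inverse_elt (1 :: 'r::ring_1) = 1"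
  by (rule invertible_eltI[of _ 1]; simp) (rule inverse_elt_eqI; simp)

lemma
  assumes "invertible_elt (a :: 'r::ring_1)"
  shows invertible_elt_minus: "invertible_elt (- a)"
    and inverse_elt_minus: "inverse_elt (- a) = - inverse_elt a"
  using assms by (auto intro: invertible_eltI[of _ "- inverse_elt a"] inverse_elt_eqI simp: inverse_elt)

lemma invertible_elt_nonzero: "invertible_elt a \<Longrightarrow> a \<noteq> (0 :: 'r::ring_1)"
  by (auto simp: invertible_elt_def)

subsection \<open>The grading of the free algebra\<close>

text \<open>One integer degree for each index. A letter \<open>LinInv \<alpha>\<close> gets degree
  zero because it inverts a combination of quotients of \<open>x\<close> by \<open>y\<close> with
  equal index, each of degree zero.\<close>

primrec letter_deg :: "'i gen_B \<Rightarrow> 'i \<Rightarrow> int"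
  where
    "letter_deg (XY g) = (\<lambda>i. case g of X m \<Rightarrow> of_bool (i = m) | Y m \<Rightarrow> of_bool (i = m)
      | Yinv m \<Rightarrow> - of_bool (i = m))"
  | "letter_deg (LinInv \<alpha>) = (\<lambda>i. 0)"

primrec word_deg :: "'i gen_B list \<Rightarrow> 'i \<Rightarrow> int"
  where
    "word_deg [] = (\<lambda>i. 0)"
  | "word_deg (g # w) = (\<lambda>i. letter_deg g i + word_deg w i)"

lemma word_deg_append: "word_deg (u @ w) = (\<lambda>i. word_deg u i + word_deg w i)"
  by (induction u) (auto simp: add_ac)

definition component :: "('i \<Rightarrow> int) \<Rightarrow> 'i gen_B free_alg \<Rightarrow> 'i gen_B free_alg"
  where "component \<gamma> p = Poly_Mapping.mapp (\<lambda>w c. c when word_deg (letters w) = \<gamma>) p"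

definition homogeneous :: "('i \<Rightarrow> int) \<Rightarrow> 'i gen_B free_alg \<Rightarrow> bool"
  where "homogeneous \<gamma> p \<longleftrightarrow> component \<gamma> p = p"

lemma lookup_component: "Poly_Mapping.lookup (component \<gamma> p) w =
    (Poly_Mapping.lookup p w when word_deg (letters w) = \<gamma>)"
  by (auto simp: component_def lookup_mapp in_keys_iff when_def)

lemma component_add: "component \<gamma> (p + r) = component \<gamma> p + component \<gamma> r"
  and component_diff: "component \<gamma> (p - r) = component \<gamma> p - component \<gamma> r"
  and component_0 [simp]: "component \<gamma> 0 = 0"
  and component_component: "component \<gamma> (component \<delta> p) = (if \<gamma> = \<delta> then component \<delta> p else 0)"
  by (auto intro!: poly_mapping_eqI simp: lookup_component lookup_add lookup_minus when_def)

lemma component_single: "component \<gamma> (Poly_Mapping.single (Word w) c) =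
    (if word_deg w = \<gamma> then Poly_Mapping.single (Word w) c else 0)"
  by (auto intro!: poly_mapping_eqI simp: lookup_component lookup_single when_def)

lemma component_homogeneous: "homogeneous \<delta> p \<Longrightarrow> component \<gamma> p = (if \<gamma> = \<delta> then p else 0)"
  using component_component[of \<gamma> \<delta> p] by (simp add: homogeneous_def)

lemma homogeneous_component: "homogeneous \<gamma> (component \<gamma> p)"
  by (simp add: homogeneous_def component_component)

lemma component_single_mult:
  "component \<gamma> (Poly_Mapping.single (Word u) c * p) =
    Poly_Mapping.single (Word u) c * component (\<lambda>i. \<gamma> i - word_deg u i) p"
proof (induction p rule: poly_mapping_linear_induct)
  case (single w d)
  obtain w' where w: "w = Word w'" by (cases w)
  show ?case
    by (auto simp: w mult_single component_single word_deg_append fun_eq_iff algebra_simps)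
qed (simp add: distrib_left component_add)

lemma component_mult_single:
  "component \<gamma> (p * Poly_Mapping.single (Word u) c) =
    component (\<lambda>i. \<gamma> i - word_deg u i) p * Poly_Mapping.single (Word u) c"
proof (induction p rule: poly_mapping_linear_induct)
  case (single w d)
  obtain w' where w: "w = Word w'" by (cases w)
  show ?case
    by (auto simp: w mult_single component_single word_deg_append fun_eq_iff algebra_simps)
qed (simp add: distrib_right component_add)

lemma component_homogeneous_mult:
  assumes "homogeneous \<gamma> p"
  shows "component \<delta> (p * r) = p * component (\<lambda>i. \<delta> i - \<gamma> i) r"
proof -
  have "component \<delta> (component \<gamma> p * r) = component \<gamma> p * component (\<lambda>i. \<delta> i - \<gamma> i) r"
  proof (induction p rule: poly_mapping_linear_induct)
    case (single w d)
    obtain w' where w: "w = Word w'" by (cases w)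
    show ?case by (simp add: w component_single component_single_mult)
  qed (simp add: distrib_right component_add)
  with assms show ?thesis by (simp add: homogeneous_def)
qed

lemma homogeneous_add: "homogeneous \<gamma> p \<Longrightarrow> homogeneous \<gamma> r \<Longrightarrow> homogeneous \<gamma> (p + r)"
  and homogeneous_diff: "homogeneous \<gamma> p \<Longrightarrow> homogeneous \<gamma> r \<Longrightarrow> homogeneous \<gamma> (p - r)"
  and homogeneous_0: "homogeneous \<gamma> 0"
  by (simp_all add: homogeneous_def component_add component_diff)

lemma homogeneous_mult:
  assumes "homogeneous \<gamma> p" and "homogeneous \<delta> r" and "\<epsilon> = (\<lambda>i. \<gamma> i + \<delta> i)"
  shows "homogeneous \<epsilon> (p * r)"
  using assms component_homogeneous_mult[OF assms(1)] by (simp add: homogeneous_def)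

lemma homogeneous_scal: "homogeneous (\<lambda>i. 0) (scal r)"
  by (simp add: homogeneous_def single_Word_Nil[symmetric] component_single)

lemma homogeneous_1: "homogeneous (\<lambda>i. 0) 1"
  using homogeneous_scal[of 1] by simp

lemma homogeneous_gen: "homogeneous (letter_deg g) (gen g)"
  by (simp add: homogeneous_def gen_def component_single)

lemma homogeneous_lincomb:
  assumes "\<And>i. homogeneous \<gamma> (v i)"
  shows "homogeneous \<gamma> (lincomb scal v \<alpha>)"
proof -
  have "homogeneous \<gamma> (scal r * v i)" for r i
    by (rule homogeneous_mult[OF homogeneous_scal assms]) simp
  then have "homogeneous \<gamma> (\<Sum>i\<in>A. scal (Poly_Mapping.lookup \<alpha> i) * v i)" for A
    by (induction A rule: infinite_finite_induct) (simp_all add: homogeneous_0 homogeneous_add)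
  then show ?thesis by (simp add: lincomb_def)
qed

text \<open>Every term of an exchange relation carries the same indices with the same multiplicity,
  and the relations for inverses have degree zero. Hence the grading passes to the quotient.\<close>

lemma homogeneous_rels:
  assumes "r \<in> B_rels q"
  shows "\<exists>\<gamma>. homogeneous \<gamma> r"
proof -
  note hom = homogeneous_diff homogeneous_add homogeneous_mult homogeneous_scal homogeneous_1
    homogeneous_gen homogeneous_lincomb
  let ?d = "\<lambda>m i. of_bool (i = m) :: int"
  consider (xy) "r \<in> xy_rels q scal (\<lambda>i. gen (XY (X i))) (\<lambda>i. gen (XY (Y i)))
      (\<lambda>i. gen (XY (Yinv i)))"
    | (inv) \<alpha> where "r \<in> (let s = lincomb scal (\<lambda>i. gen (XY (X i)) * gen (XY (Yinv i))) \<alpha>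
      in {s * gen (LinInv \<alpha>) - 1, gen (LinInv \<alpha>) * s - 1})"
    | (zero) \<alpha> where "r = gen (LinInv \<alpha>)"
    using assms unfolding B_rels_def by blast
  then show ?thesis
  proof cases
    case xy
    then consider (1) i where "r = gen (XY (Y i)) * gen (XY (Yinv i)) - 1 \<or>
        r = gen (XY (Yinv i)) * gen (XY (Y i)) - 1"
      | (2) i where "r = gen (XY (X i)) * gen (XY (Y i)) - scal q * gen (XY (Y i)) * gen (XY (X i))"
      | (3) i j where "r \<in>
        {gen (XY (X j)) * gen (XY (X i)) - scal (q\<^sup>2) * gen (XY (X i)) * gen (XY (X j)),
         gen (XY (Y j)) * gen (XY (Y i)) - scal (q\<^sup>2) * gen (XY (Y i)) * gen (XY (Y j)),
         gen (XY (X j)) * gen (XY (Y i)) - (scal q * gen (XY (Y i)) * gen (XY (X j)) +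
           scal (q\<^sup>2 - 1) * gen (XY (X i)) * gen (XY (Y j))),
         gen (XY (Y j)) * gen (XY (X i)) - scal q * gen (XY (X i)) * gen (XY (Y j))}"
      unfolding xy_rels_def by blast
    then show ?thesis
    proof cases
      case 1
      then have "homogeneous (\<lambda>i. 0) r"
        by (auto intro!: hom)
      then show ?thesis by blast
    next
      case (2 i)
      then have "homogeneous (\<lambda>k. ?d i k + ?d i k) r"
        by (auto intro!: hom)
      then show ?thesis by blast
    next
      case (3 i j)
      then have "homogeneous (\<lambda>k. ?d i k + ?d j k) r"
        by (auto intro!: hom simp: add.commute)
      then show ?thesis by blast
    qed
  next
    case inv
    then have "homogeneous (\<lambda>i. 0) r"
      unfolding Let_def by (auto intro!: hom)
    then show ?thesis by blast
  next
    case zero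
    then show ?thesis using homogeneous_gen by blast
  qed
qed

subsection \<open>The algebra presented by \<open>B_rels\<close>\<close>

locale presented_algebra =
  fixes q qh :: complex and \<pi> :: "'i::linorder gen_B free_alg \<Rightarrow> 'b::ring_1"
  assumes cmod_q: "cmod q = 1" and qh_square: "qh^2 = q" and presents: "presents (B_rels q) \<pi>"
begin

abbreviation "\<iota> \<equiv> Bscal \<pi>"
abbreviation "x \<equiv> Bx \<pi>"
abbreviation "y \<equiv> By \<pi>"
abbreviation "y' \<equiv> Byinv \<pi>"
abbreviation "v \<equiv> Bv qh \<pi>"
abbreviation "br \<equiv> bracket qh \<pi>"

lemma q_nonzero [simp]: "q \<noteq> 0" "qh \<noteq> 0"
  using cmod_q qh_square by auto

lemma scalar_cancel:
  "q * (inverse q * a) = a" "inverse q * (q * a) = a" "q * inverse q = 1" "inverse q * q = 1"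
  "qh * (inverse qh * a) = a" "inverse qh * (qh * a) = a" "qh * inverse qh = 1" "inverse qh * qh = 1"
  by simp_all

lemmas scalar_simps = scalar_cancel mult.commute[where 'a = complex]
  mult.left_commute[where 'a = complex] mult.assoc[where 'a = complex]

lemma
  shows pi_1 [simp]: "\<pi> 1 = 1"
    and pi_add: "\<pi> (a + b) = \<pi> a + \<pi> b"
    and pi_mult: "\<pi> (a * b) = \<pi> a * \<pi> b"
    and surj_pi: "surj \<pi>"
    and pi_eq_0_iff: "\<pi> a = 0 \<longleftrightarrow> a \<in> two_sided_ideal hull B_rels q"
  using presents unfolding presents_def by blast+

lemma pi_0 [simp]: "\<pi> 0 = 0"
  using pi_add[of 0 0] by simp

lemma pi_diff: "\<pi> (a - b) = \<pi> a - \<pi> b"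
  using pi_add[of "a - b" b] by (simp add: algebra_simps)

lemma pi_rel: "r \<in> B_rels q \<Longrightarrow> \<pi> r = 0"
  unfolding pi_eq_0_iff by (rule hull_inc)

lemma pi_sum: "\<pi> (sum f A) = (\<Sum>a\<in>A. \<pi> (f a))"
  by (induction A rule: infinite_finite_induct) (simp_all add: pi_add)

lemma pi_scal: "\<pi> (scal r) = \<iota> r"
  and pi_gen_XY: "\<pi> (gen (XY (X i))) = x i" "\<pi> (gen (XY (Y i))) = y i" "\<pi> (gen (XY (Yinv i))) = y' i"
  by (simp_all add: Bscal_def Bx_def By_def Byinv_def)

lemmas pi_simps = pi_add pi_diff pi_mult pi_scal pi_gen_XY

lemma Bscal_0 [simp]: "\<iota> 0 = 0"
  and Bscal_1 [simp]: "\<iota> 1 = 1"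
  and Bscal_add: "\<iota> (r + s) = \<iota> r + \<iota> s"
  and Bscal_mult: "\<iota> (r * s) = \<iota> r * \<iota> s"
  by (simp_all add: Bscal_def scal_add scal_mult pi_add pi_mult)

lemma Bscal_minus: "\<iota> (- r) = - \<iota> r"
  using Bscal_add[of r "- r"] by (simp add: eq_neg_iff_add_eq_0 add.commute)

lemma Bscal_diff: "\<iota> (r - s) = \<iota> r - \<iota> s"
  using Bscal_add[of r "- s"] by (simp add: Bscal_minus)

lemma Bscal_commute: "a * \<iota> r = \<iota> r * a"
proof -
  obtain p where "a = \<pi> p" using surj_pi by (meson surjE)
  then show ?thesis using scal_commute[of p r] by (metis Bscal_def pi_mult)
qed

text \<open>A separate operation for scalars lets rewriting collect them in front of a product,
  where they are multiplied as complex numbers.\<close>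

definition smult :: "complex \<Rightarrow> 'b \<Rightarrow> 'b"  (infixr "\<cdot>" 75)
  where "r \<cdot> a = \<iota> r * a"

lemma smult_simps [simp]:
  "(r \<cdot> a) * b = r \<cdot> (a * b)" "a * (r \<cdot> b) = r \<cdot> (a * b)" "r \<cdot> (s \<cdot> a) = (r * s) \<cdot> a"
  "1 \<cdot> a = a" "0 \<cdot> a = 0" "r \<cdot> 0 = 0" "(- r) \<cdot> a = - (r \<cdot> a)" "r \<cdot> (- a) = - (r \<cdot> a)"
  by (simp_all add: smult_def Bscal_mult Bscal_minus mult.assoc)
    (metis Bscal_commute mult.assoc)

lemma smult_distribs:
  "r \<cdot> (a + b) = r \<cdot> a + r \<cdot> b" "r \<cdot> (a - b) = r \<cdot> a - r \<cdot> b"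
  "(r + s) \<cdot> a = r \<cdot> a + s \<cdot> a" "(r - s) \<cdot> a = r \<cdot> a - s \<cdot> a"
  by (simp_all add: smult_def Bscal_add Bscal_diff algebra_simps)

lemma Bscal_mult_eq_smult: "\<iota> r * a = r \<cdot> a"
  by (simp add: smult_def)

lemma xy_rel:
  assumes "r \<in> xy_rels q scal (\<lambda>i. gen (XY (X i))) (\<lambda>i. gen (XY (Y i))) (\<lambda>i. gen (XY (Yinv i)))"
  shows "\<pi> r = 0"
  using assms by (intro pi_rel) (simp add: B_rels_def)

lemma y_y' [simp]: "y i * y' i = 1" "y' i * y i = 1"
  using xy_rel[of "gen (XY (Y i)) * gen (XY (Yinv i)) - 1"]
    xy_rel[of "gen (XY (Yinv i)) * gen (XY (Y i)) - 1"]
  by (auto simp: xy_rels_def pi_simps)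

lemma y_y'_cancel [simp]: "y i * (y' i * a) = a" "y' i * (y i * a) = a"
  by (simp_all flip: mult.assoc)

lemma xy_same: "x i * y i = q \<cdot> (y i * x i)"
proof -
  have "\<pi> (gen (XY (X i)) * gen (XY (Y i)) - scal q * gen (XY (Y i)) * gen (XY (X i))) = 0"
    by (rule xy_rel) (auto simp: xy_rels_def)
  then show ?thesis by (simp add: pi_simps smult_def mult.assoc)
qed

lemma
  assumes "i < j"
  shows xx: "x j * x i = q^2 \<cdot> (x i * x j)"
    and yy: "y j * y i = q^2 \<cdot> (y i * y j)"
    and xy: "x j * y i = q \<cdot> (y i * x j) + (q^2 - 1) \<cdot> (x i * y j)"
    and yx: "y j * x i = q \<cdot> (x i * y j)"
proof -
  let ?X = "\<lambda>i. gen (XY (X i)) :: 'i gen_B free_alg" and ?Y = "\<lambda>i. gen (XY (Y i)) :: 'i gen_B free_alg"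
  have "\<pi> (?X j * ?X i - scal (q^2) * ?X i * ?X j) = 0"
    "\<pi> (?Y j * ?Y i - scal (q^2) * ?Y i * ?Y j) = 0"
    "\<pi> (?X j * ?Y i - (scal q * ?Y i * ?X j + scal (q^2 - 1) * ?X i * ?Y j)) = 0"
    "\<pi> (?Y j * ?X i - scal q * ?X i * ?Y j) = 0"
    by (rule xy_rel, use assms in \<open>auto simp: xy_rels_def\<close>)+
  then show "x j * x i = q^2 \<cdot> (x i * x j)" "y j * y i = q^2 \<cdot> (y i * y j)"
    "x j * y i = q \<cdot> (y i * x j) + (q^2 - 1) \<cdot> (x i * y j)" "y j * x i = q \<cdot> (x i * y j)"
    by (simp_all add: pi_simps smult_def mult.assoc)
qed

section \<open>Commutation up to scalars; exchange relations between the \<open>y\<close> and the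
  \<open>v\<close>\<close>

definition qcomm :: "complex \<Rightarrow> 'b \<Rightarrow> 'b \<Rightarrow> bool"
  where "qcomm r a b \<longleftrightarrow> a * b = r \<cdot> (b * a)"

lemma qcomm_sym: "qcomm r a b \<Longrightarrow> r \<noteq> 0 \<Longrightarrow> qcomm (inverse r) b a"
  by (simp add: qcomm_def)

lemma qcomm_mult_right: "qcomm r a b \<Longrightarrow> qcomm s a c \<Longrightarrow> qcomm (r * s) a (b * c)"
  unfolding qcomm_def by (metis mult.assoc smult_simps(1-3))

lemma qcomm_mult_left: "qcomm r a c \<Longrightarrow> qcomm s b c \<Longrightarrow> qcomm (r * s) (a * b) c"
  unfolding qcomm_def by (metis mult.assoc mult.commute smult_simps(1-3))

lemma qcomm_smult_right: "qcomm r a b \<Longrightarrow> qcomm r a (s \<cdot> b)"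
  by (simp add: qcomm_def mult.commute)

lemma qcomm_inverse_right:
  assumes "qcomm r a b" "b * b' = 1" "b' * b = 1" "r \<noteq> 0"
  shows "qcomm (inverse r) a b'"
proof -
  have "b' * (a * b) * b' = r \<cdot> (b' * b * a * b')"
    using assms(1) by (simp add: qcomm_def mult.assoc)
  then have "b' * a = r \<cdot> (a * b')"
    using assms(2,3) by (simp add: mult.assoc)
  then show ?thesis using assms(4) by (simp add: qcomm_def)
qed

lemma qcomm_inverse_left:
  assumes "qcomm r a b" "a * a' = 1" "a' * a = 1" "r \<noteq> 0"
  shows "qcomm (inverse r) a' b"
  using qcomm_inverse_right[of "inverse r" b a a'] assms qcomm_sym by fastforce

text \<open>As \<open>v m\<close> is a multiple of \<open>x m * y' m\<close>, the element
  \<open>y i\<close> is moved past these two factors in turn. For \<open>i < m\<close> the second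
  term of the relation between \<open>x m\<close> and \<open>y i\<close> yields
  \<open>x i * y m * y' m = x i\<close>, which is the source of \<open>v i\<close>. The two formulas
  agree at \<open>m = i\<close>.\<close>

lemma y_v:
  shows y_v_le: "m \<le> i \<Longrightarrow> y i * v m = inverse q \<cdot> (v m * y i)"
    and y_v_ge: "i \<le> m \<Longrightarrow> y i * v m = q \<cdot> (v m * y i) - (q - inverse q) \<cdot> (v i * y i)"
proof -
  have v: "v m = qh \<cdot> (x m * y' m)" for m by (simp add: Bv_def smult_def mult.assoc)
  have same: "y i * x i = inverse q \<cdot> (x i * y i)" for i by (simp add: xy_same)
  have eq: "y i * v i = inverse q \<cdot> (v i * y i)" for i
  proof -
    have "y i * v i = qh \<cdot> ((y i * x i) * y' i)" by (simp add: v mult.assoc)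
    then show ?thesis by (simp add: same v mult.assoc mult.commute)
  qed
  have y'y: "y i * y' j = q^2 \<cdot> (y' j * y i)" if "i < j" for i j
    using qcomm_inverse_left[of "q^2" "y j" "y i" "y' j"] yy[OF that] by (simp add: qcomm_def)
  have y'y2: "y j * y' i = inverse (q^2) \<cdot> (y' i * y j)" if "i < j" for i j
    using qcomm_inverse_right[of "q^2" "y j" "y i" "y' i"] yy[OF that] by (simp add: qcomm_def)
  have lt: "y i * v m = inverse q \<cdot> (v m * y i)" if "m < i"
  proof -
    have "y i * v m = qh \<cdot> ((y i * x m) * y' m)" by (simp add: v mult.assoc)
    also have "\<dots> = inverse q \<cdot> (v m * y i)"
      using yx[OF that] y'y2[OF that] by (simp add: v mult.assoc power2_eq_square scalar_simps)
    finally show ?thesis .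
  qed
  show "m \<le> i \<Longrightarrow> y i * v m = inverse q \<cdot> (v m * y i)"
    using eq lt by (cases "m = i") auto
  have gt: "y i * v m = q \<cdot> (v m * y i) - (q - inverse q) \<cdot> (v i * y i)" if "i < m"
  proof -
    have eq: "y i * x m = inverse q \<cdot> (x m * y i) - (q - inverse q) \<cdot> (x i * y m)"
      using arg_cong[OF xy[OF that], of "\<lambda>a. inverse q \<cdot> a"]
      by (simp add: smult_distribs algebra_simps power2_eq_square scalar_simps)
    have "y i * v m = qh \<cdot> ((y i * x m) * y' m)" by (simp add: v mult.assoc)
    also have "\<dots> = qh \<cdot> ((inverse q \<cdot> (x m * y i) - (q - inverse q) \<cdot> (x i * y m)) * y' m)"
      by (simp only: eq)
    also have "\<dots> = q \<cdot> (v m * y i) - (q - inverse q) \<cdot> (v i * y i)"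
      using y'y[OF that]
      by (simp add: v mult.assoc algebra_simps smult_distribs power2_eq_square scalar_simps)
    finally show ?thesis .
  qed
  show "i \<le> m \<Longrightarrow> y i * v m = q \<cdot> (v m * y i) - (q - inverse q) \<cdot> (v i * y i)"
    using eq gt by (cases "m = i") (auto simp: smult_distribs)
qed

text \<open>This is the commutator \<open>(q^2 - 1) \<cdot> (v i * (v j - v i))\<close> of
  \<open>v j\<close> and \<open>v i\<close>, solved for the decreasing product. Both products are
  reduced to \<open>x i * x j * (y' j * y' i)\<close>; the square of \<open>v i\<close> appears when
  \<open>y' i\<close> passes \<open>v j\<close>.\<close>

lemma v_v:
  assumes "i \<le> j"
  shows "v j * v i = q^2 \<cdot> (v i * v j) - (q^2 - 1) \<cdot> (v i * v i)"
proof (cases "i = j")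
  case False
  with assms have ij: "i < j" by simp
  have v: "v m = qh \<cdot> (x m * y' m)" for m by (simp add: Bv_def smult_def mult.assoc)
  have x_y': "y' j * x i = inverse q \<cdot> (x i * y' j)"
    using qcomm_inverse_left[of q "y j" "x i" "y' j"] yx[OF ij] by (simp add: qcomm_def)
  have y'y': "y' j * y' i = q^2 \<cdot> (y' i * y' j)"
    using qcomm_inverse_left[of "inverse (q^2)" "y j" "y' i" "y' j"]
      qcomm_inverse_right[of "q^2" "y j" "y i" "y' i"] yy[OF ij] by (simp add: qcomm_def)
  have "v j * v i = (qh * qh) \<cdot> (x j * (y' j * x i) * y' i)"
    by (simp add: v mult.assoc)
  also have "\<dots> = x j * x i * (y' j * y' i)"
    using qh_square by (simp add: x_y' mult.assoc flip: power2_eq_square)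
  finally have ji: "v j * v i = q^2 \<cdot> (x i * x j * (y' j * y' i))"
    by (simp add: xx[OF ij])
  have y'_v_same: "y' i * v i = q \<cdot> (v i * y' i)"
    using arg_cong[OF y_v_le[of i i], of "\<lambda>a. q \<cdot> (y' i * a * y' i)"] by (simp add: mult.assoc)
  have y'_v: "y' i * v j = inverse q \<cdot> (v j * y' i) + (q - inverse q) \<cdot> (v i * y' i)"
  proof -
    have "v j * y' i = q \<cdot> (y' i * v j) - (q - inverse q) \<cdot> (y' i * v i)"
      using arg_cong[OF y_v_ge[of i j], of "\<lambda>a. y' i * a * y' i"] ij
      by (simp add: mult.assoc algebra_simps)
    from arg_cong[OF this, of "\<lambda>a. inverse q \<cdot> a"]
    show ?thesis by (simp add: y'_v_same smult_distribs algebra_simps scalar_simps)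
  qed
  have "v i * v j = qh \<cdot> (x i * (y' i * v j))" by (simp add: v mult.assoc)
  also have "\<dots> = (qh * inverse q) \<cdot> (x i * v j * y' i) + (qh * (q - inverse q)) \<cdot> (x i * v i * y' i)"
    by (simp add: y'_v algebra_simps smult_distribs)
  also have "(qh * inverse q) \<cdot> (x i * v j * y' i) = x i * x j * (y' j * y' i)"
    using qh_square by (simp add: v mult.assoc field_simps power2_eq_square)
  also have "(qh * (q - inverse q)) \<cdot> (x i * v i * y' i) = (1 - inverse (q^2)) \<cdot> (v i * v i)"
  proof -
    have "v i * v i = qh \<cdot> (x i * (y' i * v i))" by (simp add: v mult.assoc)
    moreover have "qh * (q - inverse q) = (1 - inverse (q^2)) * (qh * q)"
      by (simp add: field_simps power2_eq_square)
    ultimately show ?thesis by (simp add: y'_v_same mult.assoc scalar_simps)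
  qed
  finally have "v i * v j = x i * x j * (y' j * y' i) + (1 - inverse (q^2)) \<cdot> (v i * v i)" .
  from arg_cong[OF this, of "\<lambda>a. q^2 \<cdot> a"] show ?thesis
    by (simp add: ji smult_distribs algebra_simps)
qed (simp add: smult_distribs)

lemma bracket_eq: "br i j = y i * (v i - v j) * y j"
proof -
  have v: "v m = qh \<cdot> (x m * y' m)" for m by (simp add: Bv_def smult_def mult.assoc)
  have "y i * v i * y j = inverse q \<cdot> (v i * y i * y j)" by (simp add: y_v_le)
  also have "\<dots> = inverse qh \<cdot> (x i * y j)"
    by (simp add: v mult.assoc flip: qh_square) (simp add: power2_eq_square scalar_simps)
  finally have "y i * v i * y j = inverse qh \<cdot> (x i * y j)" .
  moreover have "y i * v j * y j = qh \<cdot> (y i * x j)"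
    by (simp add: v mult.assoc)
  ultimately show ?thesis
    by (simp add: bracket_def Bscal_mult_eq_smult algebra_simps)
qed


subsection \<open>Brackets\<close>

text \<open>For \<open>i < j\<close> the combination with coefficients -1 and 1 is nonvanishing, so
  its inverse is a generator of the algebra; \<open>v j - v i\<close> is \<open>qh\<close> times
  that combination.\<close>

lemma v_diff_invertible:
  assumes "i \<noteq> j"
  shows "invertible_elt (v i - v j)"
proof -
  have less: "invertible_elt (v j - v i)" if ij: "i < j" for i j
  proof -
    let ?\<alpha> = "Poly_Mapping.single i (-1) + Poly_Mapping.single j 1 :: 'i \<Rightarrow>\<^sub>0 complex"
    let ?s = "lincomb scal (\<lambda>i. gen (XY (X i)) * gen (XY (Yinv i))) ?\<alpha>"
    let ?L = "gen (LinInv ?\<alpha>) :: 'i gen_B free_alg"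
    have "nonvanishing q ?\<alpha>"
      by (rule nonvanishing_diff[OF q_nonzero(1) ij])
    then have "\<pi> (?s * ?L - 1) = 0" "\<pi> (?L * ?s - 1) = 0"
      by (rule_tac pi_rel, force simp: B_rels_def Let_def)+
    moreover have "v j - v i = qh \<cdot> \<pi> ?s"
      by (simp add: lincomb_scal_simps pi_simps Bv_def Bscal_mult_eq_smult mult.assoc smult_distribs)
    ultimately show ?thesis
      by (intro invertible_eltI[of _ "inverse qh \<cdot> \<pi> ?L"]) (simp_all add: pi_simps)
  qed
  show ?thesis
  proof (cases "i < j")
    case True
    then show ?thesis using invertible_elt_minus[OF less[of i j]] by simp
  next
    case False
    with assms show ?thesis by (simp add: less)
  qed
qed

lemma y_invertible: "invertible_elt (y i)" and inverse_y: "inverse_elt (y i) = y' i"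
  by (rule invertible_eltI[of _ "y' i"]; simp) (rule inverse_elt_eqI; simp)

lemma bracket_invertible: "i \<noteq> j \<Longrightarrow> invertible_elt (br i j)"
  unfolding bracket_eq by (intro invertible_elt_mult y_invertible v_diff_invertible)

lemma y_v_diff_le: "m \<le> i \<Longrightarrow> n \<le> i \<Longrightarrow> qcomm (inverse q) (y i) (v m - v n)"
  by (simp add: qcomm_def y_v_le algebra_simps smult_distribs)

text \<open>The correction term in \<open>y_v_ge\<close> does not depend on \<open>m\<close> and
  cancels in a difference.\<close>

lemma y_v_diff_ge: "i \<le> m \<Longrightarrow> i \<le> n \<Longrightarrow> qcomm q (y i) (v m - v n)"
  by (simp add: qcomm_def y_v_ge algebra_simps smult_distribs)

text \<open>The squares of \<open>v k\<close> cancel in the same way.\<close>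

lemma v_diff_v: "k \<le> m \<Longrightarrow> k \<le> n \<Longrightarrow> qcomm (q^2) (v m - v n) (v k)"
  by (simp add: qcomm_def v_v[of k m] v_v[of k n] algebra_simps smult_distribs)

lemma bracket_less: "i < j \<Longrightarrow> br i j = q \<cdot> ((v i - v j) * (y i * y j))"
  using y_v_diff_ge[of i i j] by (simp add: bracket_eq qcomm_def mult.assoc)

text \<open>Moving the left \<open>y\<close> past the difference costs \<open>q\<close> for
  increasing indices and \<open>inverse q\<close> for decreasing ones; the factor \<open>q^2\<close>
  from exchanging the two \<open>y\<close> makes up for this.\<close>

lemma bracket_minus: "br j i = - br i j"
proof -
  have *: "br j i = - br i j" if "i < j" for i j
  proof -
    have "br j i = inverse q \<cdot> ((v j - v i) * (y j * y i))"
      using y_v_diff_le[of j j i] that by (simp add: bracket_eq qcomm_def mult.assoc)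
    also have "\<dots> = q \<cdot> ((v j - v i) * (y i * y j))"
      by (simp add: yy[OF that] power2_eq_square scalar_simps)
    also have "\<dots> = - br i j"
      by (simp add: bracket_less[OF that] algebra_simps smult_distribs)
    finally show ?thesis .
  qed
  show ?thesis
    using *[of i j] *[of j i] by (cases i j rule: linorder_cases) (auto simp: bracket_eq)
qed

text \<open>For \<open>m \<le> a\<close> the factor \<open>q^2\<close> of the difference cancels the
  two factors \<open>inverse q\<close> of \<open>y a\<close> and \<open>y b\<close>. For
  \<open>b \<le> m\<close>, passing the two \<open>y\<close> turns \<open>v m\<close> into a
  combination of \<open>v m\<close>, \<open>v b\<close> and \<open>v a\<close>, and ordering the
  quadratic products shows that passing \<open>v a - v b\<close> turns it back into
  \<open>v m\<close>.\<close>

lemma bracket_v: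
  assumes "a < b" and "m \<le> a \<or> b \<le> m"
  shows "br a b * v m = v m * br a b"
proof (cases "m \<le> a")
  case True
  have "qcomm (q^2 * (inverse q * inverse q)) ((v a - v b) * (y a * y b)) (v m)"
    using True assms(1)
    by (intro qcomm_mult_left v_diff_v) (auto simp: qcomm_def y_v_le)
  then show ?thesis
    by (simp add: bracket_less[OF assms(1)] qcomm_def power2_eq_square scalar_simps)
next
  case False
  with assms have bm: "b \<le> m" by auto
  have "br a b * v m = q \<cdot> ((v a - v b) * (y a * (y b * v m)))"
    by (simp add: bracket_less[OF assms(1)] mult.assoc)
  also have "y a * (y b * v m) =
      (q^2 \<cdot> v m - (q^2 - 1) \<cdot> v b - (1 - inverse (q^2)) \<cdot> v a) * (y a * y b)"
  proof -
    have "y a * (y b * v m) = q \<cdot> ((y a * v m) * y b) - (q - inverse q) \<cdot> ((y a * v b) * y b)"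
      using bm by (simp add: y_v_ge algebra_simps smult_distribs mult.assoc)
    also have "\<dots> = (q^2 \<cdot> v m - (q^2 - 1) \<cdot> v b - (1 - inverse (q^2)) \<cdot> v a) * (y a * y b)"
      using assms(1) bm
      by (simp add: y_v_ge algebra_simps smult_distribs mult.assoc power2_eq_square scalar_simps)
    finally show ?thesis .
  qed
  also have "(v a - v b) * ((q^2 \<cdot> v m - (q^2 - 1) \<cdot> v b - (1 - inverse (q^2)) \<cdot> v a) * (y a * y b)) =
      v m * ((v a - v b) * (y a * y b))"
  proof -
    have "(v a - v b) * (q^2 \<cdot> v m - (q^2 - 1) \<cdot> v b - (1 - inverse (q^2)) \<cdot> v a) =
        v m * (v a - v b)"
    proof -
      have "a \<le> b" "a \<le> m" using assms(1) bm by auto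
      then show ?thesis
        by (simp add: v_v[of a b] v_v[of a m] v_v[OF bm] algebra_simps smult_distribs
            power2_eq_square scalar_simps)
    qed
    from arg_cong[OF this, of "\<lambda>u. u * (y a * y b)"] show ?thesis
      by (simp only: mult.assoc)
  qed
  finally show ?thesis by (simp add: bracket_less[OF assms(1)])
qed

text \<open>The product of the scalars that \<open>y m\<close> picks up from
  \<open>v a - v b\<close>, \<open>y a\<close> and \<open>y b\<close>. For \<open>m\<close> strictly
  between \<open>a\<close> and \<open>b\<close> the value is only a default;
  \<open>y_bracket\<close> excludes this range.\<close>

definition br_factor :: "'i \<Rightarrow> 'i \<Rightarrow> 'i \<Rightarrow> complex"
  where "br_factor a b m =
    (if m < a then inverse q ^ 3 else if m = a then inverse q else if m = b then q else q ^ 3)"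

lemma y_bracket:
  assumes "a < b" and "m \<le> a \<or> b \<le> m"
  shows "qcomm (br_factor a b m) (y m) (br a b)"
proof -
  have yy': "qcomm (inverse (q^2)) (y m) (y n)" if "m < n" for m n
    using qcomm_sym[of "q^2" "y n" "y m"] yy[OF that] by (simp add: qcomm_def)
  have yy: "qcomm (q^2) (y m) (y n)" if "n < m" for m n
    using yy[OF that] by (simp add: qcomm_def)
  have y1: "qcomm 1 (y m) (y n)" if "m = n" for m n using that by (simp add: qcomm_def)
  have *: ?thesis
    if "qcomm r (y m) (v a - v b)" "qcomm s (y m) (y a)" "qcomm t (y m) (y b)"
      "br_factor a b m = r * (s * t)" for r s t
    unfolding bracket_less[OF assms(1)] that(4)
    by (intro qcomm_smult_right qcomm_mult_right that)
  consider "m < a" | "m = a" | "m = b" | "b < m" using assms by fastforce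
  then show ?thesis
  proof cases
    case 1
    with assms have "qcomm q (y m) (v a - v b)" by (intro y_v_diff_ge) auto
    with 1 assms(1) show ?thesis
      by (intro *[OF _ yy' yy'])
        (auto simp: br_factor_def power2_eq_square power3_eq_cube scalar_simps)
  next
    case 2
    with assms have "qcomm q (y m) (v a - v b)" by (intro y_v_diff_ge) auto
    with 2 assms(1) show ?thesis
      by (intro *[OF _ y1 yy']) (auto simp: br_factor_def power2_eq_square scalar_simps)
  next
    case 3
    with assms have "qcomm (inverse q) (y m) (v a - v b)" by (intro y_v_diff_le) auto
    with 3 assms(1) show ?thesis
      by (intro *[OF _ yy y1]) (auto simp: br_factor_def power2_eq_square scalar_simps)
  next
    case 4
    with assms have "qcomm (inverse q) (y m) (v a - v b)" by (intro y_v_diff_le) auto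
    with 4 assms(1) show ?thesis
      by (intro *[OF _ yy yy])
        (auto simp: br_factor_def power2_eq_square power3_eq_cube scalar_simps)
  qed
qed

text \<open>In \<open>br m n = y m * (v m - v n) * y n\<close> the middle factor commutes with
  \<open>br a b\<close>, so only the two outer factors contribute scalars.\<close>

lemma bracket_bracket:
  assumes "a < b" and "m \<le> a \<or> b \<le> m" and "n \<le> a \<or> b \<le> n"
  shows "qcomm (br_factor a b m * br_factor a b n) (br m n) (br a b)"
proof -
  have "qcomm 1 (v m - v n) (br a b)"
    using bracket_v[OF assms(1,2)] bracket_v[OF assms(1,3)] by (simp add: qcomm_def algebra_simps)
  from qcomm_mult_left[OF qcomm_mult_left[OF y_bracket[OF assms(1,2)] this] y_bracket[OF assms(1,3)]]
  show ?thesis by (simp add: bracket_eq)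
qed

subsection \<open>Cross ratios\<close>

abbreviation "cr \<equiv> cross_ratio qh \<pi>"

lemma cross_ratio_invertible: "distinct [i, j, k, l] \<Longrightarrow> invertible_elt (cr i j k l)"
  unfolding cross_ratio_def
  by (intro invertible_elt_mult invertible_elt_inverse bracket_invertible) auto

lemma cross_ratio_inverse:
  assumes "distinct [i, j, k, l]"
  shows "cr i l k j = inverse_elt (cr i j k l)"
proof -
  have "i \<noteq> l" "k \<noteq> l" "k \<noteq> j" "i \<noteq> j" using assms by auto
  then show ?thesis
    by (simp add: cross_ratio_def inverse_elt_mult inverse_elt_inverse invertible_elt_mult
        invertible_elt_inverse bracket_invertible mult.assoc)
qed

text \<open>All inner factors \<open>y\<close> cancel in pairs. What remains is a cross ratio of the
  \<open>v\<close> conjugated by \<open>y i\<close>, so identities between cross ratios with the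
  same first index can be checked before conjugation.\<close>

lemma cross_ratio_eq:
  assumes "distinct [i, j, k, l]"
  shows "cr i j k l = y i * ((v i - v l) * inverse_elt (v k - v l) * (v k - v j) *
    inverse_elt (v i - v j)) * y' i"
proof -
  have inverse: "inverse_elt (br m n) = y' n * inverse_elt (v m - v n) * y' m" if "m \<noteq> n" for m n
    using v_diff_invertible[OF that]
    by (simp add: bracket_eq inverse_elt_mult invertible_elt_mult y_invertible inverse_y mult.assoc)
  have "k \<noteq> l" "i \<noteq> j" using assms by auto
  show ?thesis
    unfolding cross_ratio_def inverse[OF \<open>k \<noteq> l\<close>] inverse[OF \<open>i \<noteq> j\<close>]
    unfolding bracket_eq mult.assoc y_y'_cancel ..
qed

lemma cross_ratio_swap:
  assumes "distinct [i, j, k, l]"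
  shows "cr i j l k = 1 - cr i j k l"
proof -
  let ?D = "\<lambda>i j k l. (v i - v l) * inverse_elt (v k - v l) * (v k - v j) * inverse_elt (v i - v j)"
  have inv: "invertible_elt (v k - v l)" "invertible_elt (v i - v j)"
    using assms by (auto intro: v_diff_invertible)
  have minus: "inverse_elt (v l - v k) = - inverse_elt (v k - v l)"
    using inverse_elt_minus[OF inv(1)] by simp
  let ?K = "inverse_elt (v k - v l)"
  \<comment> \<open>Splitting \<open>v k - v j\<close> as \<open>(v k - v l) + (v l - v j)\<close>
    lets \<open>?K\<close> cancel on its right in one term and on its left in the other.\<close>
  have "(v i - v l) * ?K * (v k - v j) - (v i - v k) * ?K * (v l - v j) =
      (v i - v l) * (?K * (v k - v l)) + ((v i - v l) - (v i - v k)) * ?K * (v l - v j)"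
    by (simp add: algebra_simps)
  also have "(v i - v l) - (v i - v k) = v k - v l" by simp
  also have "(v i - v l) * (?K * (v k - v l)) + (v k - v l) * ?K * (v l - v j) = v i - v j"
    using inv(1) by (simp add: inverse_elt)
  finally have "(v i - v l) * ?K * (v k - v j) - (v i - v k) * ?K * (v l - v j) = v i - v j" .
  moreover have "?D i j k l + ?D i j l k =
      ((v i - v l) * ?K * (v k - v j) - (v i - v k) * ?K * (v l - v j)) * inverse_elt (v i - v j)"
    unfolding minus by (simp add: left_diff_distrib)
  ultimately have "?D i j k l + ?D i j l k = 1"
    using inv(2) by (simp only: inverse_elt_right)
  then have "?D i j l k = 1 - ?D i j k l"
    by (simp only: eq_diff_eq add.commute)
  moreover have "distinct [i, j, l, k]" using assms by auto
  ultimately have "cr i j l k = y i * (1 - ?D i j k l) * y' i"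
    by (simp only: cross_ratio_eq)
  also have "\<dots> = 1 - y i * ?D i j k l * y' i"
    by (simp only: right_diff_distrib left_diff_distrib mult_1_right y_y')
  finally show ?thesis by (simp only: cross_ratio_eq[OF assms])
qed


subsection \<open>The subalgebra of degree zero\<close>

text \<open>A part of \<open>A1R\<close> described without the involution, so that conjugation can
  be studied by induction. Asking for invertibility ensures that \<open>inverse_elt s\<close> is a
  genuine inverse.\<close>

inductive_set A1 :: "'b set" where
  A1_scal: "\<iota> r \<in> A1"
| A1_v: "v i \<in> A1"
| A1_inverse: "s \<in> range (lincomb \<iota> v) \<Longrightarrow> invertible_elt s \<Longrightarrow> inverse_elt s \<in> A1"
| A1_add: "a \<in> A1 \<Longrightarrow> b \<in> A1 \<Longrightarrow> a + b \<in> A1"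
| A1_mult: "a \<in> A1 \<Longrightarrow> b \<in> A1 \<Longrightarrow> a * b \<in> A1"

lemma A1_subset_A1R: "A1 \<subseteq> A1R qh \<pi> star"
proof
  fix a assume a: "a \<in> A1"
  show "a \<in> A1R qh \<pi> star"
    unfolding A1R_def hull_def
  proof (intro InterI, elim CollectE conjE)
    fix S assume S: "star_subalgebra \<iota> star S"
      and gens: "range v \<union> {inverse_elt s |s. s \<in> range (lincomb \<iota> v) \<and> s \<noteq> 0} \<subseteq> S"
    show "a \<in> S"
      using a
    proof induction
      case (A1_inverse s)
      then show ?case using gens invertible_elt_nonzero[of s] by blast
    qed (use S gens in \<open>auto simp: star_subalgebra_def\<close>)
  qed
qed

lemma range_lincomb_add:
  "a \<in> range (lincomb \<iota> v) \<Longrightarrow> b \<in> range (lincomb \<iota> v) \<Longrightarrow> a + b \<in> range (lincomb \<iota> v)"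
  by (elim rangeE) (simp flip: lincomb_add[OF Bscal_0 Bscal_add])

lemma range_lincomb_v: "r \<cdot> v m \<in> range (lincomb \<iota> v)"
  using lincomb_single[of \<iota> v m r] by (metis Bscal_0 Bscal_mult_eq_smult rangeI)

lemma lincomb_Bv: "lincomb \<iota> v \<alpha> = qh \<cdot> \<pi> (lincomb scal (\<lambda>i. gen (XY (X i)) * gen (XY (Yinv i))) \<alpha>)"
proof -
  have "\<iota> r * v i = qh \<cdot> (\<iota> r * (x i * y' i))" for r i
    by (simp add: Bv_def Bscal_mult_eq_smult mult.assoc mult.commute)
  then show ?thesis by (simp add: lincomb_def pi_sum pi_simps smult_def sum_distrib_left)
qed

lemma lincomb_conj:
  assumes "\<And>m. \<exists>s'\<in>range (lincomb \<iota> v). u * v m = s' * u"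
  shows "\<exists>s'\<in>range (lincomb \<iota> v). u * lincomb \<iota> v \<alpha> = s' * u"
proof (induction \<alpha> rule: poly_mapping_linear_induct)
  case (single m r)
  obtain \<beta> where "u * v m = lincomb \<iota> v \<beta> * u" using assms[of m] by auto
  moreover have "r \<cdot> lincomb \<iota> v \<beta> \<in> range (lincomb \<iota> v)"
  proof (induction \<beta> rule: poly_mapping_linear_induct)
    case (single i c)
    then show ?case
      using range_lincomb_v[of "r * c" i] by (simp add: lincomb_single Bscal_mult_eq_smult)
  next
    case (add p p')
    then show ?case
      by (simp add: lincomb_add[OF Bscal_0 Bscal_add] smult_distribs range_lincomb_add)
  qed
  ultimately show ?case
    by (intro bexI[of _ "r \<cdot> lincomb \<iota> v \<beta>"]) (simp_all add: lincomb_single Bscal_mult_eq_smult)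
next
  case (add p p')
  then obtain s s' where "s \<in> range (lincomb \<iota> v)" "s' \<in> range (lincomb \<iota> v)"
    "u * lincomb \<iota> v p = s * u" "u * lincomb \<iota> v p' = s' * u"
    by blast
  then show ?case
    by (intro bexI[OF _ range_lincomb_add[of s s']])
      (simp_all add: lincomb_add[OF Bscal_0 Bscal_add] distrib_left distrib_right)
qed

text \<open>Conjugation by \<open>u\<close> maps linear combinations of the \<open>v\<close> to such
  combinations, hence their inverses to inverses of such combinations, and therefore preserves
  \<open>A1\<close>.\<close>

lemma A1_conj:
  assumes v: "\<And>m. \<exists>s'\<in>range (lincomb \<iota> v). u * v m = s' * u"
    and u: "u * u' = 1" "u' * u = 1" and a: "a \<in> A1"
  shows "\<exists>a'\<in>A1. u * a = a' * u"
  using a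
proof induction
  case (A1_scal r)
  then show ?case by (intro bexI[of _ "\<iota> r"]) (auto simp: A1.A1_scal Bscal_commute)
next
  case (A1_v m)
  have "lincomb \<iota> v \<alpha> \<in> A1" for \<alpha>
    by (induction \<alpha> rule: poly_mapping_linear_induct)
      (auto simp: lincomb_single lincomb_add[OF Bscal_0 Bscal_add] intro: A1.intros)
  then show ?case using v[of m] by auto
next
  case (A1_inverse s)
  then obtain s' where s': "s' \<in> range (lincomb \<iota> v)" "u * s = s' * u"
    using lincomb_conj[OF v] by blast
  have "u * s * u' = s'" using u by (simp add: s' mult.assoc)
  moreover have "invertible_elt (u * s * u')"
    using u A1_inverse by (intro invertible_elt_mult) (auto intro: invertible_eltI)
  ultimately have inv: "invertible_elt s'" by simp
  have "inverse_elt s' * (s' * u) * inverse_elt s = inverse_elt s' * (u * s) * inverse_elt s"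
    by (simp add: s')
  then have "u * inverse_elt s = inverse_elt s' * u"
    using inv A1_inverse by (simp add: mult.assoc inverse_elt inverse_elt_cancel)
  then show ?case using A1.A1_inverse[OF s'(1) inv] by blast
next
  case (A1_add a b)
  then obtain a' b' where "a' \<in> A1" "b' \<in> A1" "u * a = a' * u" "u * b = b' * u" by blast
  then show ?case by (intro bexI[of _ "a' + b'"]) (auto simp: algebra_simps intro: A1.A1_add)
next
  case (A1_mult a b)
  then obtain a' b' where *: "a' \<in> A1" "b' \<in> A1" "u * a = a' * u" "u * b = b' * u" by blast
  have "u * (a * b) = a' * b' * u" by (metis *(3,4) mult.assoc)
  then show ?case using * by (intro bexI[of _ "a' * b'"]) (auto intro: A1.A1_mult)
qed

section \<open>Words in the \<open>y\<close> and their inverses, and the normal form of a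
  word\<close>

primrec y_letter :: "'i \<times> bool \<Rightarrow> 'b" where
  "y_letter (i, e) = (if e then y i else y' i)"

definition y_letter_deg :: "'i \<times> bool \<Rightarrow> 'i \<Rightarrow> int" where
  "y_letter_deg p = (\<lambda>i. of_bool (i = fst p) * (if snd p then 1 else -1))"

primrec y_word :: "('i \<times> bool) list \<Rightarrow> 'b" where
  "y_word [] = 1"
| "y_word (p # w) = y_letter p * y_word w"

primrec y_word_deg :: "('i \<times> bool) list \<Rightarrow> 'i \<Rightarrow> int" where
  "y_word_deg [] = (\<lambda>i. 0)"
| "y_word_deg (p # w) = (\<lambda>i. y_letter_deg p i + y_word_deg w i)"

lemma y_word_append: "y_word (u @ w) = y_word u * y_word w"
  by (induction u) (auto simp: mult.assoc)

lemma y_word_deg_append: "y_word_deg (u @ w) = (\<lambda>i. y_word_deg u i + y_word_deg w i)"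
  by (induction u) (auto simp: add.assoc)

lemma y_letter_conj: "a \<in> A1 \<Longrightarrow> \<exists>a'\<in>A1. y_letter p * a = a' * y_letter p"
proof -
  assume a: "a \<in> A1"
  obtain i e where p: "p = (i, e)" by (cases p)
  show ?thesis
  proof (cases e)
    case True
    have "\<exists>s'\<in>range (lincomb \<iota> v). y i * v m = s' * y i" for m
    proof (cases "m \<le> i")
      case True
      then show ?thesis
        by (intro bexI[OF _ range_lincomb_v[of "inverse q" m]]) (simp add: y_v_le)
    next
      case False
      then have "y i * v m = (q \<cdot> v m + (- (q - inverse q)) \<cdot> v i) * y i"
        by (simp add: y_v_ge algebra_simps smult_distribs)
      then show ?thesis using range_lincomb_add[OF range_lincomb_v range_lincomb_v] by blast
    qed
    from A1_conj[OF this y_y' a] show ?thesis by (simp add: p True)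
  next
    case False
    have y'_v_le: "y' i * v m = q \<cdot> (v m * y' i)" if "m \<le> i" for m
      using arg_cong[OF y_v_le[OF that], of "\<lambda>a. q \<cdot> (y' i * a * y' i)"] by (simp add: mult.assoc)
    have "\<exists>s'\<in>range (lincomb \<iota> v). y' i * v m = s' * y' i" for m
    proof (cases "m \<le> i")
      case True
      then show ?thesis
        by (intro bexI[OF _ range_lincomb_v[of q m]]) (simp add: y'_v_le)
    next
      case False
      then have "v m * y' i = q \<cdot> (y' i * v m) - (q - inverse q) \<cdot> (y' i * v i)"
        using arg_cong[OF y_v_ge[of i m], of "\<lambda>a. y' i * a * y' i"]
        by (simp add: mult.assoc algebra_simps)
      from arg_cong[OF this, of "\<lambda>a. inverse q \<cdot> a"]
      have "y' i * v m = (inverse q \<cdot> v m + (q - inverse q) \<cdot> v i) * y' i"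
        by (simp add: y'_v_le smult_distribs algebra_simps scalar_simps)
      then show ?thesis using range_lincomb_add[OF range_lincomb_v range_lincomb_v] by blast
    qed
    from A1_conj[OF this y_y'(2,1) a] show ?thesis by (simp add: p False)
  qed
qed

lemma y_letter_y_letter: "\<exists>c. c \<noteq> 0 \<and> qcomm c (y_letter p) (y_letter r)"
proof -
  have yy: "\<exists>c. c \<noteq> 0 \<and> qcomm c (y i) (y j)" for i j
  proof (cases i j rule: linorder_cases)
    case less
    then show ?thesis using qcomm_sym[of "q^2" "y j" "y i"] yy[OF less]
      by (intro exI[of _ "inverse (q^2)"]) (auto simp: qcomm_def)
  next
    case equal
    then show ?thesis by (intro exI[of _ 1]) (simp add: qcomm_def)
  next
    case greater
    then show ?thesis using yy[OF greater] by (intro exI[of _ "q^2"]) (auto simp: qcomm_def)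
  qed
  obtain i e j d where p: "p = (i, e)" "r = (j, d)" by (cases p, cases r)
  have "\<exists>c. c \<noteq> 0 \<and> qcomm c (y_letter p) (y j)"
  proof (cases e)
    case False
    obtain c where "c \<noteq> 0" "qcomm c (y i) (y j)" using yy by blast
    then show ?thesis using False qcomm_inverse_left[OF _ y_y', of c i "y j"]
      by (intro exI[of _ "inverse c"]) (simp add: p)
  qed (use yy p in auto)
  then obtain c where "c \<noteq> 0" "qcomm c (y_letter p) (y j)" by blast
  then show ?thesis
    using qcomm_inverse_right[OF _ y_y', of c "y_letter p" j]
    by (cases d) (auto simp: p(2) intro: exI[of _ "inverse c"])
qed

lemma y_letter_y_word: "\<exists>c. c \<noteq> 0 \<and> qcomm c (y_letter p) (y_word w)"
proof (induction w)
  case Nil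
  show ?case by (intro exI[of _ 1]) (simp add: qcomm_def)
next
  case (Cons r w)
  obtain c d where "c \<noteq> 0" "qcomm c (y_letter p) (y_word w)"
    "d \<noteq> 0" "qcomm d (y_letter p) (y_letter r)"
    using Cons y_letter_y_letter by blast
  then show ?case using qcomm_mult_right[of d _ _ c] by (intro exI[of _ "d * c"]) auto
qed

lemma y_word_deg_0:
  assumes "y_word_deg w = (\<lambda>i. 0)"
  shows "\<exists>c. y_word w = \<iota> c"
  using assms
proof (induction w rule: length_induct)
  case (1 w)
  show ?case
  proof (cases w)
    case Nil
    then show ?thesis by (intro exI[of _ 1]) simp
  next
    case (Cons p w')
    obtain i e where p: "p = (i, e)" by (cases p)
    \<comment> \<open>Otherwise all letters of index \<open>i\<close> in the word have the sign of
      the first one, and the degree at \<open>i\<close> could not vanish. Moving the first letter up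
      to its opposite costs a scalar, and the cancellation shortens the word by two.\<close>
    have "(i, \<not> e) \<in> set w'"
    proof (rule ccontr)
      assume "(i, \<not> e) \<notin> set w'"
      then have "(if e then y_word_deg w' i \<ge> 0 else y_word_deg w' i \<le> 0)"
        by (induction w') (auto simp: y_letter_deg_def)
      moreover have "y_letter_deg p i + y_word_deg w' i = 0"
        using "1.prems" Cons by (simp add: fun_eq_iff)
      ultimately show False by (auto simp: p y_letter_deg_def split: if_splits)
    qed
    then obtain u t where w': "w' = u @ (i, \<not> e) # t" by (meson split_list)
    obtain c where c: "qcomm c (y_letter p) (y_word u)" using y_letter_y_word by blast
    have "y_word w = (y_letter p * y_word u) * (y_letter (i, \<not> e) * y_word t)"
      by (simp add: Cons w' y_word_append mult.assoc)
    also have "\<dots> = c \<cdot> (y_word u * (y_letter p * y_letter (i, \<not> e) * y_word t))"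
      using c by (simp add: qcomm_def mult.assoc)
    also have "y_letter p * y_letter (i, \<not> e) = 1" by (simp add: p)
    finally have w: "y_word w = \<iota> c * y_word (u @ t)"
      by (simp add: y_word_append smult_def)
    have "y_word_deg (u @ t) = (\<lambda>i. 0)"
      using "1.prems" Cons w'
      by (auto simp: y_word_deg_append y_letter_deg_def p fun_eq_iff split: if_splits)
    moreover have "length (u @ t) < length w" by (simp add: Cons w')
    ultimately obtain d where "y_word (u @ t) = \<iota> d" using "1.IH" by blast
    then show ?thesis by (auto simp: w simp flip: Bscal_mult)
  qed
qed

lemma pi_word: "\<exists>a\<in>A1. \<exists>u. \<pi> (Poly_Mapping.single (Word w) 1) = a * y_word u \<and> y_word_deg u = word_deg w"
proof (induction w)
  case Nil
  show ?case using A1_scal[of 1] by (intro bexI[of _ 1] exI[of _ "[]"]) (auto simp: single_Word_Nil)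
next
  case (Cons g w)
  then obtain a u where a: "a \<in> A1" "\<pi> (Poly_Mapping.single (Word w) 1) = a * y_word u"
    "y_word_deg u = word_deg w" by blast
  have cons: "\<pi> (Poly_Mapping.single (Word (g # w)) 1) = \<pi> (gen g) * a * y_word u"
    by (simp add: single_Word_Cons[of g w] pi_mult a mult.assoc)
  have letter: ?case if "\<pi> (gen g) = b * y_letter p" "b \<in> A1" "y_letter_deg p = letter_deg g" for b p
  proof -
    obtain a' where a': "a' \<in> A1" "y_letter p * a = a' * y_letter p"
      using y_letter_conj[OF a(1)] by blast
    have "\<pi> (gen g) * a * y_word u = b * (y_letter p * a) * y_word u"
      by (simp only: that mult.assoc)
    also have "\<dots> = b * a' * y_word (p # u)" by (simp add: a' mult.assoc)
    finally show ?thesis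
      using that a a' A1_mult by (intro bexI[of _ "b * a'"] exI[of _ "p # u"]) (auto simp: cons)
  qed
  have no_letter: ?case if "\<pi> (gen g) \<in> A1" "letter_deg g = (\<lambda>i. 0)"
    using that a A1_mult by (intro bexI[of _ "\<pi> (gen g) * a"] exI[of _ u]) (auto simp: cons)
  show ?case
  proof (cases g)
    case (XY h)
    show ?thesis
    proof (cases h)
      case (X i)
      have "x i = \<iota> (inverse qh) * v i * y i"
        by (simp add: Bv_def Bscal_mult_eq_smult mult.assoc)
      then show ?thesis
        using A1_mult[OF A1_scal A1_v]
        by (intro letter[of "\<iota> (inverse qh) * v i" "(i, True)"])
          (auto simp: XY X pi_gen_XY y_letter_deg_def)
    next
      case (Y i)
      then show ?thesis
        using A1_scal[of 1] by (intro letter[of 1 "(i, True)"]) (auto simp: XY pi_gen_XY y_letter_deg_def)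
    next
      case (Yinv i)
      then show ?thesis
        using A1_scal[of 1] by (intro letter[of 1 "(i, False)"]) (auto simp: XY pi_gen_XY y_letter_deg_def)
    qed
  next
    case (LinInv \<alpha>)
    \<comment> \<open>For a nonvanishing combination this letter is \<open>qh\<close> times the
      inverse of the same combination of the \<open>v\<close>; otherwise the relations make it
      zero.\<close>
    have "\<pi> (gen (LinInv \<alpha>)) \<in> A1"
    proof (cases "nonvanishing q \<alpha>")
      case True
      let ?s = "lincomb scal (\<lambda>i. gen (XY (X i)) * gen (XY (Yinv i))) \<alpha>"
      have "\<pi> (?s * gen (LinInv \<alpha>) - 1) = 0" "\<pi> (gen (LinInv \<alpha>) * ?s - 1) = 0"
        using True by (rule_tac pi_rel, force simp: B_rels_def Let_def)+
      then have *: "\<pi> ?s * \<pi> (gen (LinInv \<alpha>)) = 1" "\<pi> (gen (LinInv \<alpha>)) * \<pi> ?s = 1"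
        by (simp_all add: pi_simps)
      then have "lincomb \<iota> v \<alpha> * (inverse qh \<cdot> \<pi> (gen (LinInv \<alpha>))) = 1"
        "(inverse qh \<cdot> \<pi> (gen (LinInv \<alpha>))) * lincomb \<iota> v \<alpha> = 1"
        by (simp_all add: lincomb_Bv)
      then have "inverse_elt (lincomb \<iota> v \<alpha>) = inverse qh \<cdot> \<pi> (gen (LinInv \<alpha>))"
        "invertible_elt (lincomb \<iota> v \<alpha>)"
        by (rule inverse_elt_eqI, rule invertible_eltI)
      then have "inverse qh \<cdot> \<pi> (gen (LinInv \<alpha>)) \<in> A1"
        using A1_inverse[of "lincomb \<iota> v \<alpha>"] by simp
      from A1_mult[OF A1_scal[of qh] this] show ?thesis by (simp add: Bscal_mult_eq_smult)
    next
      case False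
      then have "\<pi> (gen (LinInv \<alpha>)) = 0" by (intro pi_rel) (auto simp: B_rels_def)
      then show ?thesis using A1_scal[of 0] by simp
    qed
    then show ?thesis by (intro no_letter) (simp_all add: LinInv)
  qed
qed

section \<open>Homogeneous elements of the quotient\<close>

definition hom_elts :: "('i \<Rightarrow> int) \<Rightarrow> 'b set" where
  "hom_elts \<gamma> = \<pi> ` {p. homogeneous \<gamma> p}"

lemma hom_elts_0_subset: "hom_elts (\<lambda>i. 0) \<subseteq> A1"
proof -
  have "\<pi> (component (\<lambda>i. 0) p) \<in> A1" for p
  proof (induction p rule: poly_mapping_linear_induct)
    case (single w c)
    obtain w' where w: "w = Word w'" by (cases w)
    show ?case
    proof (cases "word_deg w' = (\<lambda>i. 0)")
      case True
      obtain a u where a: "a \<in> A1" "\<pi> (Poly_Mapping.single (Word w') 1) = a * y_word u"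
        "y_word_deg u = word_deg w'"
        using pi_word by blast
      obtain d where "y_word u = \<iota> d" using y_word_deg_0 a(3) True by metis
      moreover have "Poly_Mapping.single (Word w') c = scal c * Poly_Mapping.single (Word w') 1"
        by (simp add: mult_single flip: single_Word_Nil)
      then have "\<pi> (Poly_Mapping.single (Word w') c) = \<iota> c * (a * y_word u)"
        by (simp add: pi_simps a)
      ultimately show ?thesis
        using True a by (auto simp: w component_single intro!: A1_mult A1_scal)
    next
      case False
      then show ?thesis using A1_scal[of 0] by (simp add: w component_single)
    qed
  qed (simp add: component_add pi_add A1_add)
  then show ?thesis by (auto simp: hom_elts_def homogeneous_def) metis
qed

text \<open>An ideal with homogeneous generators contains the components of its elements:
  multiplication by a monomial merely shifts the degree of a component.\<close>

lemma pi_component_eq_0: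
  assumes "\<pi> p = 0"
  shows "\<pi> (component \<gamma> p) = 0"
proof -
  let ?T = "{p. \<forall>\<gamma>. \<pi> (component \<gamma> p) = 0}"
  have left: "\<pi> (component \<gamma> (r * p)) = 0" if "p \<in> ?T" for r p \<gamma>
  proof (induction r rule: poly_mapping_linear_induct)
    case (single w c)
    obtain w' where "w = Word w'" by (cases w)
    then show ?case using that by (simp add: component_single_mult pi_mult)
  qed (simp add: distrib_right component_add pi_add)
  have right: "\<pi> (component \<gamma> (p * r)) = 0" if "p \<in> ?T" for r p \<gamma>
  proof (induction r rule: poly_mapping_linear_induct)
    case (single w c)
    obtain w' where "w = Word w'" by (cases w)
    then show ?case using that by (simp add: component_mult_single pi_mult)
  qed (simp add: distrib_left component_add pi_add)
  have "two_sided_ideal ?T"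
    unfolding two_sided_ideal_def using left right by (auto simp: component_add pi_add)
  moreover have "B_rels q \<subseteq> ?T"
  proof
    fix r :: "'i gen_B free_alg" assume r: "r \<in> B_rels q"
    then obtain \<delta> where "homogeneous \<delta> r" using homogeneous_rels by blast
    then show "r \<in> ?T" using pi_rel[OF r] by (simp add: component_homogeneous)
  qed
  ultimately have "two_sided_ideal hull B_rels q \<subseteq> ?T" by (intro hull_minimal)
  then show ?thesis using assms pi_eq_0_iff by blast
qed

lemma hom_elts_diff:
  assumes "a \<in> hom_elts \<gamma>" and "b \<in> hom_elts \<gamma>"
  shows "a - b \<in> hom_elts \<gamma>"
proof -
  obtain p r where "a = \<pi> p" "b = \<pi> r" "homogeneous \<gamma> p" "homogeneous \<gamma> r"
    using assms by (auto simp: hom_elts_def)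
  then have "a - b = \<pi> (p - r)" "homogeneous \<gamma> (p - r)"
    by (simp_all add: pi_diff homogeneous_diff)
  then show ?thesis by (auto simp: hom_elts_def)
qed

lemma hom_elts_add:
  assumes "a \<in> hom_elts \<gamma>" and "b \<in> hom_elts \<gamma>"
  shows "a + b \<in> hom_elts \<gamma>"
proof -
  obtain p r where "a = \<pi> p" "b = \<pi> r" "homogeneous \<gamma> p" "homogeneous \<gamma> r"
    using assms by (auto simp: hom_elts_def)
  then have "a + b = \<pi> (p + r)" "homogeneous \<gamma> (p + r)"
    by (simp_all add: pi_add homogeneous_add)
  then show ?thesis by (auto simp: hom_elts_def)
qed

lemma hom_elts_mult:
  assumes "a \<in> hom_elts \<gamma>" and "b \<in> hom_elts \<delta>" and "\<epsilon> = (\<lambda>i. \<gamma> i + \<delta> i)"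
  shows "a * b \<in> hom_elts \<epsilon>"
proof -
  obtain p r where "a = \<pi> p" "b = \<pi> r" "homogeneous \<gamma> p" "homogeneous \<delta> r"
    using assms by (auto simp: hom_elts_def)
  then have "a * b = \<pi> (p * r)" "homogeneous \<epsilon> (p * r)"
    using homogeneous_mult[OF _ _ assms(3)] by (simp_all add: pi_mult)
  then show ?thesis by (auto simp: hom_elts_def)
qed

lemma hom_elts_scal: "\<iota> r \<in> hom_elts (\<lambda>i. 0)"
  unfolding hom_elts_def using homogeneous_scal by (auto simp flip: pi_scal)

lemma hom_elts_inverse:
  assumes a: "a \<in> hom_elts \<gamma>" "invertible_elt a" and \<delta>: "\<delta> = (\<lambda>i. - \<gamma> i)"
  shows "inverse_elt a \<in> hom_elts \<delta>"
proof -
  obtain d where d: "a = \<pi> d" "homogeneous \<gamma> d" using a(1) by (auto simp: hom_elts_def)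
  obtain p where p: "inverse_elt a = \<pi> p" using surj_pi by (meson surjE)
  have "\<pi> (d * p - 1) = 0" using inverse_elt_right[OF a(2)] by (simp add: pi_simps flip: d(1) p)
  \<comment> \<open>In degree zero only the component of degree \<open>\<delta>\<close> of
    \<open>p\<close> meets \<open>d\<close>, so this component alone is a right inverse of
    \<open>a\<close>.\<close>
  from pi_component_eq_0[OF this, of "\<lambda>i. 0"]
  have "a * \<pi> (component \<delta> p) = 1"
    by (simp add: component_diff component_homogeneous_mult[OF d(2)]
        component_homogeneous[OF homogeneous_1] pi_simps d \<delta>)
  then have "inverse_elt a = \<pi> (component \<delta> p)"
    using inverse_elt_cancel(2)[OF a(2)] by (metis mult_1_right)
  then show ?thesis by (auto simp: hom_elts_def homogeneous_component)
qed

lemma hom_elts_gen: "\<pi> (gen g) \<in> hom_elts (letter_deg g)"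
  unfolding hom_elts_def using homogeneous_gen by auto

lemma cross_ratio_hom:
  assumes "distinct [i, j, k, l]"
  shows "cr i j k l \<in> hom_elts (\<lambda>i. 0)"
proof -
  let ?d = "\<lambda>i k. of_bool (k = i) :: int"
  have xy: "x i \<in> hom_elts (?d i)" "y i \<in> hom_elts (?d i)" for i
    using hom_elts_gen[of "XY (X i)"] hom_elts_gen[of "XY (Y i)"] by (simp_all add: pi_gen_XY)
  have mult: "\<iota> r * a * b \<in> hom_elts (\<lambda>k. ?d i k + ?d j k)"
    if "a \<in> hom_elts (?d i)" "b \<in> hom_elts (?d j)" for r a b i j
    by (rule hom_elts_mult[OF hom_elts_mult[OF hom_elts_scal that(1) refl] that(2)]) simp
  have br: "br i j \<in> hom_elts (\<lambda>k. ?d i k + ?d j k)" for i j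
    unfolding bracket_def by (intro hom_elts_diff mult xy)
  have inv: "inverse_elt (br i j) \<in> hom_elts (\<lambda>k. - (?d i k + ?d j k))" if "i \<noteq> j" for i j
    by (rule hom_elts_inverse[OF br bracket_invertible[OF that] refl])
  have "k \<noteq> l" "i \<noteq> j" using assms by auto
  then show ?thesis
    unfolding cross_ratio_def
    by (intro hom_elts_mult[OF hom_elts_mult[OF hom_elts_mult[OF br inv refl] br refl] inv]) auto
qed

end

subsection \<open>The involution\<close>

locale presented_star_algebra = presented_algebra q qh \<pi>
  for q qh and \<pi> :: "'i::linorder gen_B free_alg \<Rightarrow> 'b::ring_1" +
  fixes star :: "'b \<Rightarrow> 'b"
  assumes B_star: "B_star \<pi> star"
begin

lemma
  shows star_add: "star (a + b) = star a + star b"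
    and star_mult: "star (a * b) = star b * star a"
    and star_star [simp]: "star (star a) = a"
    and star_x: "star (x i) = x i"
    and star_y: "star (y i) = y i"
  using B_star unfolding B_star_def by blast+

lemma star_smult: "star (r \<cdot> a) = cnj r \<cdot> star a"
  using B_star unfolding B_star_def smult_def by blast

lemma star_1 [simp]: "star 1 = 1"
  using star_mult[of "star 1" 1] by simp

lemma star_minus: "star (- a) = - star a"
  using star_smult[of "-1" a] by simp

lemma star_diff: "star (a - b) = star a - star b"
  using star_add[of a "- b"] by (simp add: star_minus)

lemma star_0 [simp]: "star 0 = 0"
  using star_diff[of 0 0] by simp

lemma
  assumes "invertible_elt a"
  shows star_invertible: "invertible_elt (star a)"
    and star_inverse: "star (inverse_elt a) = inverse_elt (star a)"
proof -
  have "star a * star (inverse_elt a) = 1" "star (inverse_elt a) * star a = 1"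
    using inverse_elt[OF assms] by (simp_all flip: star_mult)
  then show "invertible_elt (star a)" "star (inverse_elt a) = inverse_elt (star a)"
    by (auto intro: invertible_eltI inverse_elt_eqI[symmetric])
qed

lemma cnj_qh: "cnj qh = inverse qh"
proof -
  have "cmod qh ^ 2 = 1" using cmod_q by (simp flip: qh_square norm_power)
  then have "cmod qh = 1" by (simp add: abs_square_eq_1)
  then have "qh * cnj qh = 1" by (simp add: complex_norm_square[symmetric])
  then show ?thesis by (simp add: field_simps)
qed

text \<open>Conjugation exchanges \<open>qh\<close> with its inverse while reversal exchanges the
  two factors; the result is \<open>- br j i\<close>, and antisymmetry finishes.\<close>

lemma star_bracket: "star (br i j) = br i j"
proof (cases "i = j")
  case False
  have "star (br i j) = - br j i"
    by (simp add: bracket_def Bscal_mult_eq_smult star_diff star_smult star_mult star_x star_y cnj_qh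
        mult.assoc)
  then show ?thesis by (simp add: bracket_minus[of j i])
qed (simp add: bracket_eq)

lemma star_cross_ratio:
  assumes "distinct [i, j, k, l]"
  shows "star (cr i j k l) =
    inverse_elt (br i j) * br k j * inverse_elt (br k l) * br i l"
proof -
  have "invertible_elt (br k l)" "invertible_elt (br i j)"
    using assms by (auto intro: bracket_invertible)
  then show ?thesis
    by (simp add: cross_ratio_def star_mult star_inverse star_bracket mult.assoc)
qed

lemma reverse_product:
  assumes "qcomm r12 a b" "qcomm r13 a c" "qcomm r14 a d" "qcomm r23 b c" "qcomm r24 b d" "qcomm r34 c d"
  shows "a * b * c * d = (r12 * r13 * r14 * r23 * r24 * r34) \<cdot> (d * c * b * a)"
proof -
  have 1: "a * (b * (c * d)) = (r12 * (r13 * r14)) \<cdot> ((b * (c * d)) * a)"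
    using qcomm_mult_right[OF assms(1) qcomm_mult_right[OF assms(2,3)]] by (simp add: qcomm_def)
  have 2: "b * (c * d) = (r23 * r24) \<cdot> ((c * d) * b)"
    using qcomm_mult_right[OF assms(4,5)] by (simp add: qcomm_def)
  have 3: "c * d = r34 \<cdot> (d * c)" using assms(6) by (simp add: qcomm_def)
  have "a * b * c * d = a * (b * (c * d))" by (simp only: mult.assoc)
  also have "\<dots> = (r12 * (r13 * r14)) \<cdot> ((b * (c * d)) * a)" by (rule 1)
  also have "b * (c * d) = (r23 * r24) \<cdot> ((r34 \<cdot> (d * c)) * b)" by (subst 2) (simp only: 3)
  also have "(r12 * (r13 * r14)) \<cdot> ((r23 * r24) \<cdot> ((r34 \<cdot> (d * c)) * b) * a) =
      (r12 * r13 * r14 * r23 * r24 * r34) \<cdot> (d * c * b * a)"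
    by (simp add: mult.assoc)
  finally show ?thesis .
qed

text \<open>The star consists of the same four factors in opposite order. In \<open>r\<close> the
  scalar of a pair is inverted exactly when one of its two brackets occurs as an inverse and the
  other does not.\<close>

lemma star_cross_ratio_reverse:
  assumes dist: "distinct [i, j, k, l]"
    and "qcomm r1 (br i j) (br k j)" "qcomm r2 (br i j) (br k l)" "qcomm r3 (br i j) (br i l)"
    "qcomm r4 (br k j) (br k l)" "qcomm r5 (br k j) (br i l)" "qcomm r6 (br k l) (br i l)"
    and "r1 \<noteq> 0" "r2 \<noteq> 0" "r3 \<noteq> 0" "r4 \<noteq> 0" "r6 \<noteq> 0"
    and r: "r = inverse r1 * r2 * inverse r3 * inverse r4 * r5 * inverse r6"
  shows "star (cr i j k l) = r \<cdot> cr i j k l"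
proof -
  have "invertible_elt (br k l)" "invertible_elt (br i j)"
    using dist by (auto intro: bracket_invertible)
  note inv = inverse_elt[OF this(1)] inverse_elt[OF this(2)]
  have "qcomm (inverse (inverse r2)) (inverse_elt (br i j)) (inverse_elt (br k l))"
    using assms by (intro qcomm_inverse_right[OF qcomm_inverse_left[OF assms(3) inv(3,4)]] inv) simp_all
  then show ?thesis
    unfolding star_cross_ratio[OF dist] r
    unfolding cross_ratio_def
    using reverse_product[of "inverse r1" "inverse_elt (br i j)" "br k j" r2 "inverse_elt (br k l)"
        "inverse r3" "br i l" "inverse r4" r5 "inverse r6"]
      qcomm_inverse_left[OF assms(2) inv(3,4)] qcomm_inverse_left[OF assms(4) inv(3,4)]
      qcomm_inverse_right[OF assms(5) inv(1,2)] qcomm_inverse_left[OF assms(7) inv(1,2)] assms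
    by simp
qed

lemma star_cross_ratio_base:
  assumes "a < b" "b < c" "c < d"
  shows "star (cr a b c d) = q^2 \<cdot> cr a b c d" (is ?A)
    and "star (cr b a d c) = (inverse q)^2 \<cdot> cr b a d c" (is ?B)
    and "star (cr c d a b) = q^2 \<cdot> cr c d a b" (is ?C)
    and "star (cr d c b a) = (inverse q)^2 \<cdot> cr d c b a" (is ?D)
proof -
  have minus: "br b a = - br a b" "br c b = - br b c" "br d c = - br c d" "br d a = - br a d"
    by (rule bracket_minus)+
  have qcomm_minus: "qcomm r (- s) t \<longleftrightarrow> qcomm r s t" "qcomm r s (- t) \<longleftrightarrow> qcomm r s t" for r s t
    by (simp_all add: qcomm_def)
  have less: "a < c" "a < d" "b < d" using assms by auto
  note neq = assms less assms[THEN less_imp_neq] less[THEN less_imp_neq]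
    assms[THEN less_imp_neq, symmetric] less[THEN less_imp_neq, symmetric]
  have bb: "qcomm r (br m n) (br i j)"
    if "i < j" "m \<le> i \<or> j \<le> m" "n \<le> i \<or> j \<le> n" "r = br_factor i j m * br_factor i j n"
    for r i j m n
    using bracket_bracket[OF that(1-3)] that(4) by simp
  \<comment> \<open>The brackets \<open>br a b\<close>, \<open>br b c\<close>,
    \<open>br c d\<close>, \<open>br a d\<close> are numbered 1 to 4, and a fact is named after its
    left and right bracket. The right one is chosen so that no end of the left one lies strictly
    between its ends.\<close>
  have 21: "qcomm (q^4) (br b c) (br a b)" and 31: "qcomm (q^6) (br c d) (br a b)"
    and 41: "qcomm (q^2) (br a d) (br a b)" and 32: "qcomm (q^4) (br c d) (br b c)"
    and 42: "qcomm 1 (br a d) (br b c)" and 43: "qcomm (inverse (q^2)) (br a d) (br c d)"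
    by (rule bb; use assms in \<open>auto simp: br_factor_def eval_nat_numeral scalar_simps\<close>)+
  have 12: "qcomm (inverse (q^4)) (br a b) (br b c)" and 13: "qcomm (inverse (q^6)) (br a b) (br c d)"
    and 14: "qcomm (inverse (q^2)) (br a b) (br a d)" and 23: "qcomm (inverse (q^4)) (br b c) (br c d)"
    and 24: "qcomm 1 (br b c) (br a d)" and 34: "qcomm (q^2) (br c d) (br a d)"
    using qcomm_sym[OF 21] qcomm_sym[OF 31] qcomm_sym[OF 41] qcomm_sym[OF 32] qcomm_sym[OF 42]
      qcomm_sym[OF 43] by simp_all
  show ?A
    by (rule star_cross_ratio_reverse[of a b c d "inverse (q^4)" "inverse (q^6)" "inverse (q^2)" "inverse (q^4)" 1 "q^2"],
        simp_all only: minus qcomm_minus 12 13 14 23 24 34 21 31 41 32 42 43)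
      (simp_all add: neq eval_nat_numeral scalar_simps)
  show ?B
    by (rule star_cross_ratio_reverse[of b a d c "inverse (q^2)" "inverse (q^6)" "inverse (q^4)" "inverse (q^2)" 1 "q^4"],
        simp_all only: minus qcomm_minus 12 13 14 23 24 34 21 31 41 32 42 43)
      (simp_all add: neq eval_nat_numeral scalar_simps)
  show ?C
    by (rule star_cross_ratio_reverse[of c d a b "q^2" "q^6" "q^4" "q^2" 1 "inverse (q^4)"],
        simp_all only: minus qcomm_minus 12 13 14 23 24 34 21 31 41 32 42 43)
      (simp_all add: neq eval_nat_numeral scalar_simps)
  show ?D
    by (rule star_cross_ratio_reverse[of d c b a "q^4" "q^6" "q^2" "q^4" 1 "inverse (q^2)"],
        simp_all only: minus qcomm_minus 12 13 14 23 24 34 21 31 41 32 42 43)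
      (simp_all add: neq eval_nat_numeral scalar_simps)
qed

subsection \<open>The rational functions\<close>


text \<open>The last equation is invariance of the fraction at \<open>t\<close> after clearing
  denominators. It makes sense even if the denominator at \<open>t\<close> has no inverse.\<close>

definition family_invariant :: "family \<Rightarrow> complex \<Rightarrow> 'b \<Rightarrow> bool" where
  "family_invariant F t z \<longleftrightarrow>
    invertible_elt (snd (family_fun F \<iota> (t^2) z)) \<and>
    star z = fst (family_fun F \<iota> (t^2) z) * inverse_elt (snd (family_fun F \<iota> (t^2) z)) \<and>
    star (fst (family_fun F \<iota> t z)) * snd (family_fun F \<iota> t z) =
    star (snd (family_fun F \<iota> t z)) * fst (family_fun F \<iota> t z)"

lemma Bscal_eq_smult: "\<iota> r = r \<cdot> 1"
  by (simp add: smult_def)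

lemma inverse_cancel:
  fixes r t :: complex
  assumes "t \<noteq> 0"
  shows "t * (inverse t * r) = r" and "inverse t * (t * r) = r"
  using assms by simp_all

lemma invertible_elt_cancel_right:
  "invertible_elt c \<Longrightarrow> a * c = b * c \<Longrightarrow> a = (b :: 'b)"
  by (metis inverse_elt_right mult.assoc mult_1_right)

text \<open>The parameter \<open>t\<close> stands for \<open>q\<close> or
  \<open>inverse q\<close>.\<close>

context
  fixes t :: complex
  assumes t: "cnj t = inverse t" "t \<noteq> 0"
begin

text \<open>Conjugation inverts \<open>t\<close>, so \<open>star (t \<cdot> z)\<close> has the
  scalar \<open>inverse t * t^2 = t\<close>.\<close>

lemma family_invariant_F1:
  assumes "star z = t^2 \<cdot> z"
  shows "family_invariant F1 t z"
  by (simp add: family_invariant_def Bscal_mult_eq_smult star_smult power2_eq_square assms t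
      inverse_cancel)

lemma family_invariant_F2:
  assumes "star z = inverse (t^2) \<cdot> z"
  shows "family_invariant F2 t z"
  by (simp add: family_invariant_def Bscal_mult_eq_smult star_smult power2_eq_square assms t
      inverse_cancel)

lemma family_invariant_F3:
  assumes "star z = t^2 \<cdot> z + (1 - t^2) \<cdot> 1"
  shows "family_invariant F3 t z"
  by (simp add: family_invariant_def Bscal_eq_smult star_smult star_add star_diff smult_distribs
      power2_eq_square inverse_cancel algebra_simps assms t)

lemma family_invariant_F6:
  assumes "star z = inverse (t^2) \<cdot> z + (1 - inverse (t^2)) \<cdot> 1"
  shows "family_invariant F6 t z"
  by (simp add: family_invariant_def Bscal_eq_smult star_smult star_add star_diff smult_distribs
      power2_eq_square inverse_cancel algebra_simps assms t)

text \<open>The value of \<open>F5\<close> at \<open>z\<close> is the formal reciprocal of the value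
  of \<open>F3\<close> at the inverse of \<open>z\<close>. The denominator at \<open>t^2\<close> is
  \<open>star (inverse_elt z) * z\<close>, hence invertible. The identity at \<open>t\<close> is
  proved after multiplication by this element, which can be cancelled even where the denominator at
  \<open>t\<close> cannot.\<close>

lemma family_invariant_F5:
  assumes z: "invertible_elt z" and star: "star (inverse_elt z) = t^2 \<cdot> inverse_elt z + (1 - t^2) \<cdot> 1"
  shows "family_invariant F5 t z"
proof -
  let ?E = "t^2 \<cdot> 1 + (1 - t^2) \<cdot> z"
  have E: "?E = star (inverse_elt z) * z"
    using z by (simp add: star distrib_right inverse_elt)
  have inv: "invertible_elt ?E"
    unfolding E by (intro invertible_elt_mult star_invertible invertible_elt_inverse z)
  have sE: "star z * ?E = z"
    using z by (simp add: E star_inverse inverse_elt_cancel star_invertible)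
  have "star z * (t \<cdot> 1 + (1 - t) \<cdot> z) * ?E = star z * ?E * (t \<cdot> 1 + (1 - t) \<cdot> z)"
    by (simp add: algebra_simps smult_distribs)
  also have "\<dots> = z * (t \<cdot> 1 + (1 - t) \<cdot> z)" by (simp only: sE)
  \<comment> \<open>The denominator at \<open>t\<close> equals
    \<open>inverse t \<cdot> ?E + (1 - inverse t) \<cdot> z\<close>, and \<open>sE\<close> exhibits
    \<open>?E\<close> as a right factor of \<open>z\<close>.\<close>
  also have "\<dots> = (inverse t \<cdot> ?E + (1 - inverse t) \<cdot> (star z * ?E)) * z"
    unfolding sE using t(2) by (simp add: algebra_simps smult_distribs power2_eq_square inverse_cancel)
  also have "\<dots> = (inverse t \<cdot> 1 + (1 - inverse t) \<cdot> star z) * z * ?E"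
    by (simp add: algebra_simps smult_distribs)
  finally have "star z * (t \<cdot> 1 + (1 - t) \<cdot> z) = (inverse t \<cdot> 1 + (1 - inverse t) \<cdot> star z) * z"
    by (rule invertible_elt_cancel_right[OF inv])
  moreover have "star z = z * inverse_elt ?E"
    using arg_cong[OF sE, of "\<lambda>a. a * inverse_elt ?E"] inv
    by (simp only: mult.assoc inverse_elt_right mult_1_right)
  ultimately show ?thesis
    using inv t
    by (simp add: family_invariant_def Bscal_mult_eq_smult Bscal_eq_smult star_add star_smult)
qed

text \<open>In the same way \<open>F4\<close> is the formal reciprocal of \<open>F6\<close> at the
  inverse; here the denominator at \<open>t^2\<close> carries an additional factor
  \<open>t^2\<close>.\<close>

lemma family_invariant_F4:
  assumes z: "invertible_elt z"
    and star: "star (inverse_elt z) = inverse (t^2) \<cdot> inverse_elt z + (1 - inverse (t^2)) \<cdot> 1"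
  shows "family_invariant F4 t z"
proof -
  let ?E = "1 + (t^2 - 1) \<cdot> z"
  have E: "?E = (t^2 \<cdot> star (inverse_elt z)) * z"
    using z t(2) by (simp add: star smult_distribs algebra_simps inverse_elt)
  have inv: "invertible_elt ?E"
    unfolding E
  proof (intro invertible_elt_mult z)
    have "invertible_elt (star (inverse_elt z))"
      by (intro star_invertible invertible_elt_inverse z)
    then show "invertible_elt (t\<^sup>2 \<cdot> star (inverse_elt z))"
      using t(2) by (intro invertible_eltI[of _ "inverse (t^2) \<cdot> inverse_elt (star (inverse_elt z))"])
        (simp_all add: inverse_elt)
  qed
  have sE: "star z * ?E = t^2 \<cdot> z"
    using z by (simp add: E star_inverse inverse_elt_cancel star_invertible)
  have "inverse t \<cdot> star z * (1 + (t - 1) \<cdot> z) * ?E = inverse t \<cdot> (star z * ?E) * (1 + (t - 1) \<cdot> z)"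
    by (simp add: algebra_simps smult_distribs)
  also have "\<dots> = (?E + (inverse t - 1) \<cdot> (star z * ?E)) * (t \<cdot> z)"
    unfolding sE using t(2)
    by (simp add: algebra_simps smult_distribs power2_eq_square inverse_cancel)
  also have "\<dots> = (1 + (inverse t - 1) \<cdot> star z) * (t \<cdot> z) * ?E"
    by (simp add: algebra_simps smult_distribs)
  finally have "inverse t \<cdot> star z * (1 + (t - 1) \<cdot> z) = (1 + (inverse t - 1) \<cdot> star z) * (t \<cdot> z)"
    by (rule invertible_elt_cancel_right[OF inv])
  moreover have "star z = t^2 \<cdot> z * inverse_elt ?E"
    using arg_cong[OF sE, of "\<lambda>a. a * inverse_elt ?E"] inv
    by (simp only: mult.assoc inverse_elt_right mult_1_right)
  ultimately show ?thesis
    using inv t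
    by (simp add: family_invariant_def Bscal_mult_eq_smult star_add star_smult)
qed

text \<open>Exchanging the last two indices replaces a cross ratio by 1 minus it, and exchanging the
  second and fourth inverts it. These moves generate all orders of \<open>j\<close>,
  \<open>k\<close>, \<open>l\<close>, and the six families are the resulting forms of
  \<open>z \<mapsto> t^2 \<cdot> z\<close>.\<close>

lemma family_invariant_orbit:
  assumes dist: "distinct [i, j, k, l]" and star: "star (cr i j k l) = t^2 \<cdot> cr i j k l"
  shows "family_invariant F1 t (cr i j k l)" "family_invariant F2 t (cr i l k j)"
    "family_invariant F3 t (cr i j l k)" "family_invariant F4 t (cr i k j l)"
    "family_invariant F5 t (cr i k l j)" "family_invariant F6 t (cr i l j k)"
proof -
  note inv = cross_ratio_invertible[OF dist]
  have star2: "star (cr i l k j) = inverse (t^2) \<cdot> cr i l k j"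
  proof -
    have "inverse_elt (t^2 \<cdot> cr i j k l) = inverse (t^2) \<cdot> inverse_elt (cr i j k l)"
      by (rule inverse_elt_eqI) (use t(2) inv in \<open>simp_all add: inverse_elt\<close>)
    then show ?thesis
      by (simp add: cross_ratio_inverse[OF dist] star_inverse[OF inv] star)
  qed
  have star3: "star (cr i j l k) = t^2 \<cdot> cr i j l k + (1 - t^2) \<cdot> 1"
    by (simp add: cross_ratio_swap[OF dist] star_diff star smult_distribs)
  have star6: "star (cr i l j k) = inverse (t^2) \<cdot> cr i l j k + (1 - inverse (t^2)) \<cdot> 1"
  proof -
    have "distinct [i, l, k, j]" using dist by auto
    then show ?thesis by (simp add: cross_ratio_swap[of i l k j] star_diff star2 smult_distribs)
  qed
  have inverse5: "cr i j l k = inverse_elt (cr i k l j)" and inv5: "invertible_elt (cr i k l j)"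
    using dist by (intro cross_ratio_inverse cross_ratio_invertible; auto)+
  have inverse4: "cr i l j k = inverse_elt (cr i k j l)" and inv4: "invertible_elt (cr i k j l)"
    using dist by (intro cross_ratio_inverse cross_ratio_invertible; auto)+
  show "family_invariant F1 t (cr i j k l)" by (rule family_invariant_F1[OF star])
  show "family_invariant F2 t (cr i l k j)" by (rule family_invariant_F2[OF star2])
  show "family_invariant F3 t (cr i j l k)" by (rule family_invariant_F3[OF star3])
  show "family_invariant F6 t (cr i l j k)" by (rule family_invariant_F6[OF star6])
  show "family_invariant F5 t (cr i k l j)"
    by (rule family_invariant_F5[OF inv5 star3[unfolded inverse5]])
  show "family_invariant F4 t (cr i k j l)"
    by (rule family_invariant_F4[OF inv4 star6[unfolded inverse4]])
qed

end

lemma family_fun_hom: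
  assumes "z \<in> hom_elts (\<lambda>i. 0)"
  shows "fst (family_fun F \<iota> t z) \<in> hom_elts (\<lambda>i. 0)"
    and "snd (family_fun F \<iota> t z) \<in> hom_elts (\<lambda>i. 0)"
proof -
  have "\<iota> r * z \<in> hom_elts (\<lambda>i. 0)" for r
    by (rule hom_elts_mult[OF hom_elts_scal assms]) simp
  moreover have "1 \<in> hom_elts (\<lambda>i. 0)"
    using hom_elts_scal[of 1] by simp
  ultimately show "fst (family_fun F \<iota> t z) \<in> hom_elts (\<lambda>i. 0)"
    "snd (family_fun F \<iota> t z) \<in> hom_elts (\<lambda>i. 0)"
    by (cases F; simp add: assms hom_elts_add hom_elts_scal)+
qed

lemma hom_elts_0_A1R: "a \<in> hom_elts (\<lambda>i. 0) \<Longrightarrow> a \<in> A1R qh \<pi> star"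
  using hom_elts_0_subset A1_subset_A1R by blast

section \<open>The twenty-four orders of the indices\<close>

definition invariant :: "'i \<Rightarrow> 'i \<Rightarrow> 'i \<Rightarrow> 'i \<Rightarrow> bool" where
  "invariant i j k l \<longleftrightarrow> (let C = cr i j k l in
    (invertible_elt (f_den i j k l \<iota> (q^2) C) \<and> star C = f_val i j k l \<iota> (q^2) C) \<and>
    (invertible_elt (f_den i j k l \<iota> q C) \<longrightarrow>
      f_val i j k l \<iota> q C \<in> A1R qh \<pi> star \<and>
      star (f_val i j k l \<iota> q C) = f_val i j k l \<iota> q C) \<and>
    (f_num i j k l \<iota> q C \<in> A1R qh \<pi> star \<and> f_den i j k l \<iota> q C \<in> A1R qh \<pi> star \<and>
      star (f_num i j k l \<iota> q C) * f_den i j k l \<iota> q C =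
      star (f_den i j k l \<iota> q C) * f_num i j k l \<iota> q C))"

text \<open>The map \<open>\<sigma>\<close> is the identity or inversion, according to whether the
  order uses its family with \<open>t\<close> or with \<open>inverse t\<close>.\<close>

lemma invariantI:
  assumes dist: "distinct [i, j, k, l]"
    and fam: "family_invariant F (\<sigma> q) (cr i j k l)"
    and f: "\<And>t z. f_frac i j k l \<iota> t z = family_fun F \<iota> (\<sigma> t) z"
    and \<sigma>: "\<sigma> (q^2) = (\<sigma> q)^2"
  shows "invariant i j k l"
proof -
  let ?C = "cr i j k l"
  let ?N = "fst (family_fun F \<iota> (\<sigma> q) ?C)" and ?D = "snd (family_fun F \<iota> (\<sigma> q) ?C)"
  note hom = family_fun_hom[OF cross_ratio_hom[OF dist], of F "\<sigma> q"]
  have eq: "star ?N * ?D = star ?D * ?N" using fam by (simp add: family_invariant_def)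
  have "?N * inverse_elt ?D \<in> A1R qh \<pi> star \<and> star (?N * inverse_elt ?D) = ?N * inverse_elt ?D"
    if inv: "invertible_elt ?D"
  proof
    show "?N * inverse_elt ?D \<in> A1R qh \<pi> star"
      by (rule hom_elts_0_A1R[OF hom_elts_mult[OF hom(1) hom_elts_inverse[OF hom(2) inv refl]]]) simp
    have "star (?N * inverse_elt ?D) = inverse_elt (star ?D) * (star ?N * ?D) * inverse_elt ?D"
      using inv by (simp add: star_mult star_inverse mult.assoc inverse_elt_right)
    also have "\<dots> = ?N * inverse_elt ?D"
      using star_invertible[OF inv] by (simp add: eq mult.assoc inverse_elt_cancel)
    finally show "star (?N * inverse_elt ?D) = ?N * inverse_elt ?D" .
  qed
  then show ?thesis
    using fam eq hom hom_elts_0_A1R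
    by (simp add: invariant_def family_invariant_def f_val_def f \<sigma>)
qed

lemma cnj_q: "cnj q = inverse q"
  using cnj_qh by (simp flip: qh_square add: power_inverse)

lemma invariant_all:
  assumes dist: "distinct [i, j, k, l]"
  shows "invariant i j k l"
proof -
  define s where "s = sort [i, j, k, l]"
  have "length s = 4" by (simp add: s_def)
  then obtain a b c d where s: "s = [a, b, c, d]"
    by (auto simp: numeral_eq_Suc length_Suc_conv)
  have "sorted s" "distinct s"
    unfolding s_def distinct_sort by (rule sorted_sort, rule dist)
  then have less: "a < b" "b < c" "c < d" by (auto simp: s)
  have set: "{i, j, k, l} = {a, b, c, d}"
    using arg_cong[OF s, of set] unfolding s_def set_sort by simp
  have sort: "sort [i, j, k, l] = [a, b, c, d]" using s unfolding s_def .
  have neq: "a \<noteq> b" "a \<noteq> c" "a \<noteq> d" "b \<noteq> c" "b \<noteq> d" "c \<noteq> d"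
    "b \<noteq> a" "c \<noteq> a" "d \<noteq> a" "c \<noteq> b" "d \<noteq> b" "d \<noteq> c"
    using less by auto
  have t: "cnj (inverse q) = inverse (inverse q)" "inverse q \<noteq> 0" "q \<noteq> 0" by (simp_all add: cnj_q)
  note base = star_cross_ratio_base[OF less]
  have "distinct [a, b, c, d]" "distinct [b, a, d, c]" "distinct [c, d, a, b]" "distinct [d, c, b, a]"
    using neq by auto
  \<comment> \<open>Four base orders with six families each: facts 1 to 6 and 13 to 18 have
    parameter \<open>q\<close>, the others \<open>inverse q\<close>. Each family thus occurs at two
    positions that differ by 12.\<close>
  note orbit = family_invariant_orbit[OF cnj_q t(3) this(1) base(1)]
    family_invariant_orbit[OF t(1,2) this(2) base(2)]
    family_invariant_orbit[OF cnj_q t(3) this(3) base(3)]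
    family_invariant_orbit[OF t(1,2) this(4) base(4)]
  have f: "f_frac i j k l \<iota> t z = (
      let p = (i, j, k, l) in
      if p \<in> {(a,b,c,d), (c,d,a,b)} then family_fun F1 \<iota> t z
      else if p \<in> {(a,d,c,b), (c,b,a,d)} then family_fun F2 \<iota> t z
      else if p \<in> {(a,b,d,c), (c,d,b,a)} then family_fun F3 \<iota> t z
      else if p \<in> {(a,c,b,d), (c,a,d,b)} then family_fun F4 \<iota> t z
      else if p \<in> {(a,c,d,b), (c,a,b,d)} then family_fun F5 \<iota> t z
      else if p \<in> {(a,d,b,c), (c,b,d,a)} then family_fun F6 \<iota> t z
      else if p \<in> {(b,a,d,c), (d,c,b,a)} then family_fun F1 \<iota> (inverse t) z
      else if p \<in> {(b,c,d,a), (d,a,b,c)} then family_fun F2 \<iota> (inverse t) z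
      else if p \<in> {(b,a,c,d), (d,c,a,b)} then family_fun F3 \<iota> (inverse t) z
      else if p \<in> {(b,d,a,c), (d,b,c,a)} then family_fun F4 \<iota> (inverse t) z
      else if p \<in> {(b,d,c,a), (d,b,a,c)} then family_fun F5 \<iota> (inverse t) z
      else family_fun F6 \<iota> (inverse t) z)" for t z
    unfolding f_frac_def sort by (simp only: Let_def nth_Cons_0 nth_Cons_numeral nth_Cons_Suc
        One_nat_def numeral_2_eq_2 numeral_3_eq_3)
  have plus: ?thesis
    if "family_invariant F q (cr i j k l)" "\<And>t z. f_frac i j k l \<iota> t z = family_fun F \<iota> t z" for F
    using invariantI[OF dist, of F "\<lambda>t. t"] that by simp
  have minus: ?thesis
    if "family_invariant F (inverse q) (cr i j k l)"
      "\<And>t z. f_frac i j k l \<iota> t z = family_fun F \<iota> (inverse t) z" for F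
    using invariantI[OF dist, of F inverse] that by (simp add: power_inverse)
  have "i \<in> {a, b, c, d}" "j \<in> {a, b, c, d}" "k \<in> {a, b, c, d}" "l \<in> {a, b, c, d}"
    using set by blast+
  \<comment> \<open>The twelve pairs exhaust all arrangements, so the final branch of
    \<open>f_frac\<close> is reached only by the last pair.\<close>
  then have "(i, j, k, l) \<in> {(a,b,c,d), (c,d,a,b)} \<or>
      (i, j, k, l) \<in> {(a,d,c,b), (c,b,a,d)} \<or>
      (i, j, k, l) \<in> {(a,b,d,c), (c,d,b,a)} \<or>
      (i, j, k, l) \<in> {(a,c,b,d), (c,a,d,b)} \<or>
      (i, j, k, l) \<in> {(a,c,d,b), (c,a,b,d)} \<or>
      (i, j, k, l) \<in> {(a,d,b,c), (c,b,d,a)} \<or>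
      (i, j, k, l) \<in> {(b,a,d,c), (d,c,b,a)} \<or>
      (i, j, k, l) \<in> {(b,c,d,a), (d,a,b,c)} \<or>
      (i, j, k, l) \<in> {(b,a,c,d), (d,c,a,b)} \<or>
      (i, j, k, l) \<in> {(b,d,a,c), (d,b,c,a)} \<or>
      (i, j, k, l) \<in> {(b,d,c,a), (d,b,a,c)} \<or>
      (i, j, k, l) \<in> {(b,c,a,d), (d,a,c,b)}"
    by (elim insertE emptyE; hypsubst; use dist in simp)
  then show ?thesis
  proof (elim disjE, goal_cases)
    case 1
    show ?case
    proof (rule plus)
      show "family_invariant F1 q (cr i j k l)"
        using 1 orbit(1,13) by auto
    qed (unfold f, use 1 neq in auto)
  next
    case 2
    show ?case
    proof (rule plus)
      show "family_invariant F2 q (cr i j k l)"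
        using 2 orbit(2,14) by auto
    qed (unfold f, use 2 neq in auto)
  next
    case 3
    show ?case
    proof (rule plus)
      show "family_invariant F3 q (cr i j k l)"
        using 3 orbit(3,15) by auto
    qed (unfold f, use 3 neq in auto)
  next
    case 4
    show ?case
    proof (rule plus)
      show "family_invariant F4 q (cr i j k l)"
        using 4 orbit(4,16) by auto
    qed (unfold f, use 4 neq in auto)
  next
    case 5
    show ?case
    proof (rule plus)
      show "family_invariant F5 q (cr i j k l)"
        using 5 orbit(5,17) by auto
    qed (unfold f, use 5 neq in auto)
  next
    case 6
    show ?case
    proof (rule plus)
      show "family_invariant F6 q (cr i j k l)"
        using 6 orbit(6,18) by auto
    qed (unfold f, use 6 neq in auto)
  next
    case 7
    show ?case
    proof (rule minus)
      show "family_invariant F1 (inverse q) (cr i j k l)"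
        using 7 orbit(7,19) by auto
    qed (unfold f, use 7 neq in auto)
  next
    case 8
    show ?case
    proof (rule minus)
      show "family_invariant F2 (inverse q) (cr i j k l)"
        using 8 orbit(8,20) by auto
    qed (unfold f, use 8 neq in auto)
  next
    case 9
    show ?case
    proof (rule minus)
      show "family_invariant F3 (inverse q) (cr i j k l)"
        using 9 orbit(9,21) by auto
    qed (unfold f, use 9 neq in auto)
  next
    case 10
    show ?case
    proof (rule minus)
      show "family_invariant F4 (inverse q) (cr i j k l)"
        using 10 orbit(10,22) by auto
    qed (unfold f, use 10 neq in auto)
  next
    case 11
    show ?case
    proof (rule minus)
      show "family_invariant F5 (inverse q) (cr i j k l)"
        using 11 orbit(11,23) by auto
    qed (unfold f, use 11 neq in auto)
  next
    case 12
    show ?case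
    proof (rule minus)
      show "family_invariant F6 (inverse q) (cr i j k l)"
        using 12 orbit(12,24) by auto
    qed (unfold f, use 12 neq in auto)
  qed
qed

end

theorem lemma13:
  fixes q qh :: complex
    and \<pi> :: "'i::linorder gen_B free_alg \<Rightarrow> 'b::ring_1"
    and star :: "'b \<Rightarrow> 'b"
    and i j k l :: 'i
  assumes "cmod q = 1" and "q \<notin> {1, -1, \<i>, -\<i>}" and "qh^2 = q"
    and "presents (B_rels q) \<pi>"
    and "B_star \<pi> star"
    and "distinct [i, j, k, l]"
  defines "C \<equiv> cross_ratio qh \<pi> i j k l"
  shows
    "(invertible_elt (f_den i j k l (Bscal \<pi>) (q^2) C) \<and>
      star C = f_val i j k l (Bscal \<pi>) (q^2) C) \<and>
     (invertible_elt (f_den i j k l (Bscal \<pi>) q C) \<longrightarrow>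
      f_val i j k l (Bscal \<pi>) q C \<in> A1R qh \<pi> star \<and>
      star (f_val i j k l (Bscal \<pi>) q C) = f_val i j k l (Bscal \<pi>) q C) \<and>
     (f_num i j k l (Bscal \<pi>) q C \<in> A1R qh \<pi> star \<and>
      f_den i j k l (Bscal \<pi>) q C \<in> A1R qh \<pi> star \<and>
      star (f_num i j k l (Bscal \<pi>) q C) * f_den i j k l (Bscal \<pi>) q C =
      star (f_den i j k l (Bscal \<pi>) q C) * f_num i j k l (Bscal \<pi>) q C)"
proof -
  interpret presented_star_algebra q qh \<pi> star
    using assms by unfold_locales
  show ?thesis
    using invariant_all[OF assms(6)] unfolding invariant_def Let_def C_def .
qed

end
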